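(* Let $R$ be a purely infinite ring (not necessarily unital), and assume that $V(R)$ is a refinement monoid. If $e\in R$ is an idempotent, and $\overline{[e]}$ is not irreducible in any quotient $V(R)/I$ of $V(R)$ by an ideal $I$ of $V(R)$, then $M_n(eRe)$ is properly purely infinite for every $n\in\mathbb{N}$. In particular, if $e\neq 0$, then $e$ is properly infinite.
   Context: Rings are associative and not necessarily unital. For $a\in R$, $RaR$ denotes the set of finite sums $\sum_i r_ias_i$ with $r_i,s_i\in R$. A ring $R$ is purely infinite if (i) no quotient of $R$ is a division ring, and (ii) whenever $a\in R$ and $b\in RaR$, there exist $x,y\in R$ with $b=xay$. An element $a\in R$ is properly infinite if $a\neq 0$ and there exist $\alpha_1,\alpha_2,\beta_1,\beta_2\in R$ with $\alpha_i a\beta_j=\delta_{ij}a$ for all $i,j\in\{1,2\}$. A ring is properly purely infinite if every nonzero element of it is properly infinite. Idempotent matrices $p\in M_m(R)$ and $q\in M_n(R)$ are equivalent if $p=xy$ and $q=yx$ for some $m\times n$ matrix $x$ and $n\times m$ matrix $y$ over $R$. $V(R)$ is the abelian monoid of equivalence classes $[p]$ of idempotent square matrices (of all sizes) over $R$, with $[p]+[q]=[p\oplus q]$ (block diagonal sum). Let $V$ be an abelian monoid. The algebraic preordering is: $x\le y$ iff $x+z=y$ for some $z\in V$. $V$ is a refinement monoid if whenever $x_1+x_2=y_1+y_2$ in $V$ there exist $z_{ij}\in V$ with $z_{i1}+z_{i2}=x_i$ ($i=1,2$) and $z_{1j}+z_{2j}=y_j$ ($j=1,2$). An ideal of $V$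 is a submonoid $I$ such that $x+y\in I$ implies $x,y\in I$. $V/I$ is the quotient of $V$ by the congruence $x\equiv_I y$ iff $x+a=y+b$ for some $a,b\in I$; overbars denote classes in $V/I$. A unit of $V$ is an element with an additive inverse. An element $u\in V$ is irreducible if $u$ is not a unit and, whenever $u=a+b$ with $a,b\in V$, either $a$ or $b$ is a unit. *)

theory Defs
  imports "Jordan_Normal_Form.Matrix"
begin

section \<open>Non-unital rings\<close>

text \<open>
  Associative, not necessarily unital rings \<open>R\<close> are types of class \<open>ring\<close>. Rings built from
  such an \<open>R\<close> (quotients, matrix rings over corners) live on carrier sets. Since the records of
  HOL-Algebra carry a designated identity, the following record without identity is used for them.
\<close>

record 'a rng = "'a partial_object" +
  rmult :: "'a \<Rightarrow> 'a \<Rightarrow> 'a" (infixl \<open>\<cdot>\<index>\<close> 70)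
  radd :: "'a \<Rightarrow> 'a \<Rightarrow> 'a"
  rzero :: 'a

definition type_rng :: "'a::ring rng" where
  "type_rng = \<lparr>carrier = UNIV, rmult = (*), radd = (+), rzero = 0\<rparr>"

definition with_one :: "'a rng \<Rightarrow> 'a \<Rightarrow> 'a Ring.ring" where
  "with_one Q u = \<lparr>carrier = carrier Q, mult = rmult Q, one = u, zero = rzero Q, add = radd Q\<rparr>"

text \<open>The equation for the units also excludes the zero ring, in which zero is a unit.\<close>

definition division_rng :: "'a rng \<Rightarrow> bool" where
  "division_rng Q \<longleftrightarrow>
     (\<exists>u. Ring.ring (with_one Q u) \<and> Units (with_one Q u) = carrier Q - {rzero Q})"

definition two_sided_ideal :: "'a::ring set \<Rightarrow> bool" where
  "two_sided_ideal I \<longleftrightarrow>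
     0 \<in> I \<and> (\<forall>x\<in>I. \<forall>y\<in>I. x - y \<in> I) \<and> (\<forall>r. \<forall>x\<in>I. r * x \<in> I \<and> x * r \<in> I)"

definition ideal_rel :: "'a::ring set \<Rightarrow> ('a \<times> 'a) set" where
  "ideal_rel I = {(x, y). x - y \<in> I}"

definition quotient_rng :: "'a::ring set \<Rightarrow> 'a set rng" where
  "quotient_rng I =
     \<lparr>carrier = UNIV // ideal_rel I,
      rmult = (\<lambda>X Y. \<Union>x\<in>X. \<Union>y\<in>Y. ideal_rel I `` {x * y}),
      radd = (\<lambda>X Y. \<Union>x\<in>X. \<Union>y\<in>Y. ideal_rel I `` {x + y}),
      rzero = ideal_rel I `` {0}\<rparr>"

definition RaR :: "'a::ring \<Rightarrow> 'a set" where
  "RaR a = {\<Sum>i<n. r i * a * s i | (n::nat) r s. True}"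

definition purely_infinite :: "'a::ring itself \<Rightarrow> bool" where
  "purely_infinite _ \<longleftrightarrow>
     (\<forall>I::'a set. two_sided_ideal I \<longrightarrow> \<not> division_rng (quotient_rng I)) \<and>
     (\<forall>(a::'a) b. b \<in> RaR a \<longrightarrow> (\<exists>x y. b = x * a * y))"

definition properly_infinite :: "'a rng \<Rightarrow> 'a \<Rightarrow> bool" where
  "properly_infinite Q a \<longleftrightarrow> a \<noteq> rzero Q \<and>
     (\<exists>\<alpha>\<^sub>1\<in>carrier Q. \<exists>\<alpha>\<^sub>2\<in>carrier Q. \<exists>\<beta>\<^sub>1\<in>carrier Q. \<exists>\<beta>\<^sub>2\<in>carrier Q.
        \<alpha>\<^sub>1 \<cdot>\<^bsub>Q\<^esub> a \<cdot>\<^bsub>Q\<^esub> \<beta>\<^sub>1 = a \<and> \<alpha>\<^sub>1 \<cdot>\<^bsub>Q\<^esub> a \<cdot>\<^bsub>Q\<^esub> \<beta>\<^sub>2 = rzero Q \<and>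
        \<alpha>\<^sub>2 \<cdot>\<^bsub>Q\<^esub> a \<cdot>\<^bsub>Q\<^esub> \<beta>\<^sub>1 = rzero Q \<and> \<alpha>\<^sub>2 \<cdot>\<^bsub>Q\<^esub> a \<cdot>\<^bsub>Q\<^esub> \<beta>\<^sub>2 = a)"

definition properly_purely_infinite :: "'a rng \<Rightarrow> bool" where
  "properly_purely_infinite Q \<longleftrightarrow>
     (\<forall>a\<in>carrier Q. a \<noteq> rzero Q \<longrightarrow> properly_infinite Q a)"

definition corner :: "'a::ring \<Rightarrow> 'a set" where
  "corner e = {e * r * e | r. True}"

definition matrix_rng :: "nat \<Rightarrow> 'a::ring set \<Rightarrow> 'a mat rng" where
  "matrix_rng n S =
     \<lparr>carrier = {A \<in> carrier_mat n n. elements_mat A \<subseteq> S},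
      rmult = (*), radd = (+), rzero = 0\<^sub>m n n\<rparr>"


section \<open>Abelian monoids\<close>

text \<open>
  Abelian monoids are the structures \<open>comm_monoid\<close> of HOL-Algebra, so that the operation written
  additively in the mathematics is \<open>\<otimes>\<close> and its neutral element is \<open>\<one>\<close>. An element is a unit if it
  lies in \<open>Units\<close>.
\<close>

locale refinement_monoid = comm_monoid M for M (structure) +
  assumes refinement:
    "\<lbrakk>x\<^sub>1 \<in> carrier M; x\<^sub>2 \<in> carrier M; y\<^sub>1 \<in> carrier M; y\<^sub>2 \<in> carrier M; x\<^sub>1 \<otimes> x\<^sub>2 = y\<^sub>1 \<otimes> y\<^sub>2\<rbrakk> \<Longrightarrow>
     \<exists>z\<^sub>1\<^sub>1\<in>carrier M. \<exists>z\<^sub>1\<^sub>2\<in>carrier M. \<exists>z\<^sub>2\<^sub>1\<in>carrier M. \<exists>z\<^sub>2\<^sub>2\<in>carrier M.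
       z\<^sub>1\<^sub>1 \<otimes> z\<^sub>1\<^sub>2 = x\<^sub>1 \<and> z\<^sub>2\<^sub>1 \<otimes> z\<^sub>2\<^sub>2 = x\<^sub>2 \<and> z\<^sub>1\<^sub>1 \<otimes> z\<^sub>2\<^sub>1 = y\<^sub>1 \<and> z\<^sub>1\<^sub>2 \<otimes> z\<^sub>2\<^sub>2 = y\<^sub>2"

locale monoid_ideal = submonoid I M for I and M (structure) +
  assumes summands:
    "\<lbrakk>x \<in> carrier M; y \<in> carrier M; x \<otimes> y \<in> I\<rbrakk> \<Longrightarrow> x \<in> I \<and> y \<in> I"

definition monoid_rel :: "('a, 'b) monoid_scheme \<Rightarrow> 'a set \<Rightarrow> ('a \<times> 'a) set" where
  "monoid_rel M I = {(x, y) \<in> carrier M \<times> carrier M. \<exists>a\<in>I. \<exists>b\<in>I. x \<otimes>\<^bsub>M\<^esub> a = y \<otimes>\<^bsub>M\<^esub> b}"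

definition quotient_monoid :: "('a, 'b) monoid_scheme \<Rightarrow> 'a set \<Rightarrow> 'a set monoid" where
  "quotient_monoid M I =
     \<lparr>carrier = carrier M // monoid_rel M I,
      mult = (\<lambda>X Y. \<Union>x\<in>X. \<Union>y\<in>Y. monoid_rel M I `` {x \<otimes>\<^bsub>M\<^esub> y}),
      one = monoid_rel M I `` {\<one>\<^bsub>M\<^esub>}\<rparr>"

text \<open>
  This is not \<open>irreducible\<close> of HOL-Algebra, which is phrased with proper factors and differs in
  monoids without cancellation.
\<close>

definition monoid_irreducible :: "('a, 'b) monoid_scheme \<Rightarrow> 'a \<Rightarrow> bool" where
  "monoid_irreducible M u \<longleftrightarrow> u \<in> carrier M \<and> u \<notin> Units M \<and>
     (\<forall>a\<in>carrier M. \<forall>b\<in>carrier M. u = a \<otimes>\<^bsub>M\<^esub> b \<longrightarrow> a \<in> Units M \<or> b \<in> Units M)"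


section \<open>The monoid V(R)\<close>

definition idem_mats :: "'a::ring mat set" where
  "idem_mats = {p. square_mat p \<and> p * p = p}"

definition idem_rel :: "('a::ring mat \<times> 'a mat) set" where
  "idem_rel = {(p, q) \<in> idem_mats \<times> idem_mats.
     \<exists>x\<in>carrier_mat (dim_row p) (dim_row q). \<exists>y\<in>carrier_mat (dim_row q) (dim_row p).
       p = x * y \<and> q = y * x}"

text \<open>
  The empty matrix is admitted as an idempotent. It is equivalent to all zero matrices, so this
  does not change the monoid. The library term \<open>diag_block_mat [p, q]\<close> is the block diagonal sum.
\<close>

definition V_monoid :: "'a::ring itself \<Rightarrow> 'a mat set monoid" where
  "V_monoid _ =
     \<lparr>carrier = idem_mats // idem_rel,
      mult = (\<lambda>X Y. \<Union>p\<in>X. \<Union>q\<in>Y. idem_rel `` {diag_block_mat [p, q]}),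
      one = idem_rel `` {0\<^sub>m 0 0}\<rparr>"

definition V_class :: "'a::ring \<Rightarrow> 'a mat set" where
  "V_class e = idem_rel `` {mat 1 1 (\<lambda>_. e)}"

end

theory Submission
  imports Defs "HOL-Algebra.Divisibility"
begin

text \<open>
  Put \<open>u = [e]\<close>. The heart of the matter is the inequality \<open>2u \<le> u\<close> in \<open>V(R)\<close>; it says that
  there are elements with \<open>\<alpha>\<^sub>i e \<beta>\<^sub>j = \<delta>\<^sub>i\<^sub>j e\<close>, and the rest follows by multiplying with these.

  Pure infiniteness enters \<open>V(R)\<close> as follows. The algebraic preordering is described by
  \<open>[p] \<le> [q]\<close> if and only if \<open>p = x q y\<close> for some matrices (\<open>V_divides_iff\<close>). If \<open>2y \<le> u\<close>, with
  \<open>y = [f]\<close>, then \<open>R\<close> contains orthogonal idempotents \<open>h\<close> and \<open>h'\<close>, both equivalent to \<open>f\<close>. Their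
  sum lies in \<open>RhR\<close>, so it has the form \<open>v h w\<close>, which means \<open>2y \<le> y\<close>
  (\<open>double_dominated_of_double_dominated_by_entry\<close>).

  In a refinement monoid this implication, together with the absence of irreducible images, yields
  \<open>2u \<le> u\<close> (\<open>double_divides_of_no_irreducible_image\<close>). The elements \<open>y \<le> u\<close> with \<open>2y \<le> y\<close> form an
  upward directed set, so the elements below them form an ideal \<open>J\<close>. If \<open>u \<in> J\<close>, then \<open>u\<close> lies
  below some such \<open>y \<le> u\<close> and \<open>2u \<le> 2y \<le> y \<le> u\<close>. Otherwise let \<open>P\<close> be an ideal that contains
  \<open>J\<close> and is maximal among the ideals avoiding \<open>u\<close>. Since the class of \<open>u\<close> modulo \<open>P\<close> is not
  irreducible, \<open>u = a + b\<close> with \<open>a, b \<notin> P\<close>; by maximality \<open>a \<le> u \<le> p + n b\<close> for some \<open>p \<in> P\<close>,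
  and Riesz decomposition produces some \<open>c \<notin> P\<close> with \<open>c \<le> a\<close> and \<open>c \<le> b\<close>. Then \<open>2c \<le> a + b = u\<close>,
  hence \<open>2c \<le> c\<close> and \<open>c \<in> J \<subseteq> P\<close>, a contradiction.

  Finally let \<open>a \<in> eRe\<close>. The element \<open>\<beta>\<^sub>1 a \<alpha>\<^sub>1 + \<beta>\<^sub>2 a \<alpha>\<^sub>2\<close> of \<open>RaR\<close> is of the form \<open>x a y\<close>, and
  multiplying it by \<open>\<alpha>\<^sub>i\<close> on the left and by \<open>\<beta>\<^sub>j\<close> on the right shows that \<open>a\<close> is properly infinite
  unless it is zero. The powers of \<open>\<alpha>\<^sub>2\<close> and \<open>\<beta>\<^sub>2\<close> provide arbitrarily long biorthogonal families,
  which embed \<open>M\<^sub>n(eRe)\<close> into \<open>eRe\<close> and carry the result over to matrices.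
\<close>

section \<open>Ideals and quotients of abelian monoids\<close>

context comm_monoid
begin

lemma divides_mult_mono:
  assumes "a \<in> carrier G" "b \<in> carrier G" "c \<in> carrier G" "d \<in> carrier G"
    and "a divides b" "c divides d"
  shows "(a \<otimes> c) divides (b \<otimes> d)"
  using assms by (meson divides_mult_lI divides_mult_rI divides_trans m_closed)

lemma monoid_ideal_iff:
  "monoid_ideal I G \<longleftrightarrow> I \<subseteq> carrier G \<and> \<one> \<in> I \<and> (\<forall>x\<in>I. \<forall>y\<in>I. x \<otimes> y \<in> I) \<and>
     (\<forall>y\<in>I. \<forall>x\<in>carrier G. x divides y \<longrightarrow> x \<in> I)"
  (is "_ \<longleftrightarrow> ?R")
proof
  assume I: "monoid_ideal I G"
  then have S: "submonoid I G"
    by (rule monoid_ideal.axioms)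
  have "x \<in> I" if "y \<in> I" "x \<in> carrier G" "x divides y" for x y
  proof -
    from that(3) obtain z where "z \<in> carrier G" "y = x \<otimes> z"
      by (auto simp: factor_def)
    then show ?thesis
      using monoid_ideal.summands[OF I that(2)] that(1) by blast
  qed
  then show ?R
    using S unfolding submonoid_def by blast
next
  assume R: ?R
  have "x \<in> I \<and> y \<in> I" if "x \<in> carrier G" "y \<in> carrier G" "x \<otimes> y \<in> I" for x y
  proof -
    have "x divides (x \<otimes> y)" "y divides (x \<otimes> y)"
      using that by (auto intro: divides_prod_l)
    then show ?thesis
      using R that by blast
  qed
  then show "monoid_ideal I G"
    using R unfolding monoid_ideal_def monoid_ideal_axioms_def submonoid_def by blast
qed

lemma equiv_monoid_rel:
  assumes "monoid_ideal I G"
  shows "equiv (carrier G) (monoid_rel G I)"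
proof (rule equivI)
  have I: "I \<subseteq> carrier G" "\<one> \<in> I" "\<And>x y. x \<in> I \<Longrightarrow> y \<in> I \<Longrightarrow> x \<otimes> y \<in> I"
    using assms by (auto simp: monoid_ideal_iff)
  show "monoid_rel G I \<subseteq> carrier G \<times> carrier G"
    by (auto simp: monoid_rel_def)
  show "refl_on (carrier G) (monoid_rel G I)"
    using I(2) by (auto simp: refl_on_def monoid_rel_def)
  show "sym (monoid_rel G I)"
    by (auto simp: sym_def monoid_rel_def) metis
  show "trans (monoid_rel G I)"
  proof (rule transI)
    fix x y z assume "(x, y) \<in> monoid_rel G I" "(y, z) \<in> monoid_rel G I"
    then obtain a b c d where m: "a \<in> I" "b \<in> I" "c \<in> I" "d \<in> I"
      and C: "x \<in> carrier G" "y \<in> carrier G" "z \<in> carrier G"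
      and eq: "x \<otimes> a = y \<otimes> b" "y \<otimes> c = z \<otimes> d"
      by (auto simp: monoid_rel_def)
    have mC: "a \<in> carrier G" "b \<in> carrier G" "c \<in> carrier G" "d \<in> carrier G"
      using m I(1) by auto
    have "x \<otimes> (a \<otimes> c) = (y \<otimes> c) \<otimes> b"
      using C mC eq(1) by (metis m_assoc m_comm)
    also have "\<dots> = z \<otimes> (d \<otimes> b)"
      using C mC eq(2) by (simp add: m_assoc)
    finally show "(x, z) \<in> monoid_rel G I"
      using C m I(3) by (auto simp: monoid_rel_def)
  qed
qed

lemma class_eq_iff:
  assumes "monoid_ideal I G" "x \<in> carrier G" "y \<in> carrier G"
  shows "monoid_rel G I `` {x} = monoid_rel G I `` {y} \<longleftrightarrow> (\<exists>a\<in>I. \<exists>b\<in>I. x \<otimes> a = y \<otimes> b)"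
  unfolding eq_equiv_class_iff[OF equiv_monoid_rel[OF assms(1)] assms(2,3)]
  using assms(2,3) by (simp add: monoid_rel_def)

lemma quotient_mult:
  assumes "monoid_ideal I G" "x \<in> carrier G" "y \<in> carrier G"
  shows "(monoid_rel G I `` {x}) \<otimes>\<^bsub>quotient_monoid G I\<^esub> (monoid_rel G I `` {y}) =
    monoid_rel G I `` {x \<otimes> y}"
proof -
  have I: "I \<subseteq> carrier G" "\<And>x y. x \<in> I \<Longrightarrow> y \<in> I \<Longrightarrow> x \<otimes> y \<in> I"
    using assms by (auto simp: monoid_ideal_iff)
  have "congruent2 (monoid_rel G I) (monoid_rel G I) (\<lambda>x y. monoid_rel G I `` {x \<otimes> y})"
  proof (rule congruent2I')
    fix x x' y y' assume "(x, x') \<in> monoid_rel G I" "(y, y') \<in> monoid_rel G I"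
    then obtain a b c d where m: "a \<in> I" "b \<in> I" "c \<in> I" "d \<in> I"
      and C: "x \<in> carrier G" "x' \<in> carrier G" "y \<in> carrier G" "y' \<in> carrier G"
      and eq: "x \<otimes> a = x' \<otimes> b" "y \<otimes> c = y' \<otimes> d"
      by (auto simp: monoid_rel_def)
    have mC: "a \<in> carrier G" "b \<in> carrier G" "c \<in> carrier G" "d \<in> carrier G"
      using m I(1) by auto
    have "x \<otimes> y \<otimes> (a \<otimes> c) = (x \<otimes> a) \<otimes> (y \<otimes> c)"
      using C mC by (simp add: m_ac)
    also have "\<dots> = x' \<otimes> y' \<otimes> (b \<otimes> d)"
      unfolding eq using C mC by (simp add: m_ac)
    finally have "\<exists>i\<in>I. \<exists>j\<in>I. x \<otimes> y \<otimes> i = x' \<otimes> y' \<otimes> j"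
      using m I(2) by blast
    then show "monoid_rel G I `` {x \<otimes> y} = monoid_rel G I `` {x' \<otimes> y'}"
      using C by (simp add: class_eq_iff[OF assms(1)])
  qed
  from UN_equiv_class2[OF equiv_monoid_rel[OF assms(1)] equiv_monoid_rel[OF assms(1)] this assms(2,3)]
  show ?thesis
    by (simp add: quotient_monoid_def)
qed

text \<open>
  An ideal contains the summands of its elements, so an equation \<open>x + y + a = b\<close> with \<open>b\<close> in the
  ideal, which is what the invertibility of the image of \<open>x\<close> amounts to, forces \<open>x\<close> into it.
\<close>

lemma class_unit_iff:
  assumes I: "monoid_ideal I G" and x: "x \<in> carrier G"
  shows "monoid_rel G I `` {x} \<in> Units (quotient_monoid G I) \<longleftrightarrow> x \<in> I"
proof -
  let ?c = "\<lambda>x. monoid_rel G I `` {x}"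
  have I': "I \<subseteq> carrier G" "\<one> \<in> I" "\<And>x y. x \<in> I \<Longrightarrow> y \<in> I \<Longrightarrow> x \<otimes> y \<in> I"
    "\<And>x y. x \<in> carrier G \<Longrightarrow> y \<in> I \<Longrightarrow> x divides y \<Longrightarrow> x \<in> I"
    using I unfolding monoid_ideal_iff by blast+
  have car: "carrier (quotient_monoid G I) = ?c ` carrier G"
    by (auto simp: quotient_monoid_def quotient_def)
  have one: "\<one>\<^bsub>quotient_monoid G I\<^esub> = ?c \<one>"
    by (simp add: quotient_monoid_def)
  show ?thesis
  proof
    assume "?c x \<in> Units (quotient_monoid G I)"
    then obtain y where y: "y \<in> carrier G" and "?c (x \<otimes> y) = ?c \<one>"
      using x by (auto simp: Units_def car one quotient_mult[OF I])
    then obtain a b where ab: "a \<in> I" "b \<in> I" "x \<otimes> y \<otimes> a = \<one> \<otimes> b"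
      using class_eq_iff[OF I] x by auto
    have C: "a \<in> carrier G" "b \<in> carrier G"
      using ab I'(1) by auto
    have "b = x \<otimes> (y \<otimes> a)"
      using ab(3) x y C by (simp add: m_assoc)
    then have "x divides b"
      using y C by (intro dividesI[of "y \<otimes> a"]) simp_all
    then show "x \<in> I"
      by (rule I'(4)[OF x ab(2)])
  next
    assume "x \<in> I"
    then have "?c x = ?c \<one>"
      using class_eq_iff[OF I x one_closed] x I'(2) by (metis l_one m_comm one_closed)
    then show "?c x \<in> Units (quotient_monoid G I)"
      by (auto simp: Units_def car one quotient_mult[OF I])
  qed
qed

end

section \<open>Elements without irreducible images in a refinement monoid\<close>

context refinement_monoid
begin

lemma Riesz_decomposition:
  assumes "x \<in> carrier M" "y \<in> carrier M" "z \<in> carrier M" "x divides (y \<otimes> z)"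
  obtains x\<^sub>1 x\<^sub>2 where "x\<^sub>1 \<in> carrier M" "x\<^sub>2 \<in> carrier M" "x = x\<^sub>1 \<otimes> x\<^sub>2"
    "x\<^sub>1 divides y" "x\<^sub>2 divides z"
proof -
  obtain w where w: "w \<in> carrier M" "x \<otimes> w = y \<otimes> z"
    using assms by (auto simp: factor_def)
  show ?thesis
    using refinement[OF assms(1) w(1) assms(2,3) w(2)] that by (metis dividesI')
qed

text \<open>
  A decomposition of the image of \<open>u\<close> in the quotient lifts: it means \<open>u + i = a + b + j\<close> with
  \<open>i\<close> and \<open>j\<close> in the ideal, and a refinement of this equation decomposes \<open>u\<close> itself into
  two summands that differ from \<open>a\<close> and \<open>b\<close> only by elements of the ideal.
\<close>

lemma not_irreducible_split:
  assumes I: "monoid_ideal I M" and u: "u \<in> carrier M" "u \<notin> I"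
    and irr: "\<not> monoid_irreducible (quotient_monoid M I) (monoid_rel M I `` {u})"
  obtains a b where "a \<in> carrier M" "b \<in> carrier M" "a \<notin> I" "b \<notin> I" "u = a \<otimes> b"
proof -
  let ?c = "\<lambda>x. monoid_rel M I `` {x}"
  have I': "I \<subseteq> carrier M" "\<And>x y. x \<in> I \<Longrightarrow> y \<in> I \<Longrightarrow> x \<otimes> y \<in> I"
    "\<And>x y. x \<in> carrier M \<Longrightarrow> y \<in> I \<Longrightarrow> x divides y \<Longrightarrow> x \<in> I"
    using I unfolding monoid_ideal_iff by blast+
  have car: "carrier (quotient_monoid M I) = ?c ` carrier M"
    by (auto simp: quotient_monoid_def quotient_def)
  obtain a b where ab: "a \<in> carrier M" "b \<in> carrier M" "a \<notin> I" "b \<notin> I" "?c u = ?c (a \<otimes> b)"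
    using irr u class_unit_iff[OF I]
    by (auto simp: monoid_irreducible_def car quotient_mult[OF I])
  obtain i j where ij: "i \<in> I" "j \<in> I" "u \<otimes> i = a \<otimes> b \<otimes> j"
    using ab class_eq_iff[OF I] u by auto
  have iC: "i \<in> carrier M" "j \<in> carrier M"
    using ij I' by auto
  then have "u \<otimes> i = a \<otimes> (b \<otimes> j)"
    using ij ab by (simp add: m_assoc)
  from refinement[OF u(1) iC(1) ab(1) _ this]
  obtain p q r s where z: "p \<in> carrier M" "q \<in> carrier M" "r \<in> carrier M" "s \<in> carrier M"
      "p \<otimes> q = u" "r \<otimes> s = i" "p \<otimes> r = a" "q \<otimes> s = b \<otimes> j"
    using ab iC by (metis m_closed)
  have rs: "r \<in> I" "s \<in> I"
    using monoid_ideal.summands[OF I z(3,4)] z(6) ij by auto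
  have "p \<notin> I"
    using I'(2)[of p r] z rs ab by auto
  moreover have "q \<notin> I"
    using I'(2)[of q s] z rs ab iC monoid_ideal.summands[OF I ab(2) iC(2)] by auto
  ultimately show ?thesis
    using that z by auto
qed

text \<open>
  By Riesz decomposition \<open>x\<close> is the sum of an element below \<open>p\<close> and of \<open>n\<close> elements below \<open>b\<close>. The
  first lies in the ideal, so one of the others does not.
\<close>

lemma common_divisor_outside_ideal:
  assumes I: "monoid_ideal I M" and C: "x \<in> carrier M" "p \<in> I" "b \<in> carrier M"
    and "x divides (p \<otimes> b [^] (n::nat))" and "x \<notin> I"
  shows "\<exists>c\<in>carrier M. c \<notin> I \<and> c divides x \<and> c divides b"
  using C(1) assms(5,6)
proof (induction n arbitrary: x)
  have I': "I \<subseteq> carrier M" "\<And>x y. x \<in> I \<Longrightarrow> y \<in> I \<Longrightarrow> x \<otimes> y \<in> I"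
    "\<And>x y. x \<in> carrier M \<Longrightarrow> y \<in> I \<Longrightarrow> x divides y \<Longrightarrow> x \<in> I"
    using I unfolding monoid_ideal_iff by blast+
  have pC: "p \<in> carrier M"
    using I' C by auto
  {
    case 0
    then have "x divides p"
      using pC by simp
    then show ?case
      using 0 I'(3) C(2) by blast
  next
    case (Suc n)
    have "x divides ((p \<otimes> b [^] n) \<otimes> b)"
      using Suc.prems pC C by (simp add: m_assoc)
    then obtain y z where yz: "y \<in> carrier M" "z \<in> carrier M" "x = y \<otimes> z"
      "y divides (p \<otimes> b [^] n)" "z divides b"
      using Riesz_decomposition[of x "p \<otimes> b [^] n" b] Suc.prems pC C by auto
    have dv: "y divides x" "z divides x"
      using yz by (auto intro: divides_prod_l)
    show ?case
    proof (cases "z \<in> I")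
      case True
      then have "y \<notin> I"
        using Suc.prems yz I'(2) by auto
      then obtain c where "c \<in> carrier M" "c \<notin> I" "c divides y" "c divides b"
        using Suc.IH[of y] yz by auto
      then show ?thesis
        using dv yz by (meson divides_trans)
    next
      case False
      then show ?thesis
        using dv yz by auto
    qed
  }
qed

lemma maximal_ideal_avoiding:
  assumes "monoid_ideal J M" "u \<notin> J"
  obtains P where "monoid_ideal P M" "J \<subseteq> P" "u \<notin> P"
    "\<And>Q. monoid_ideal Q M \<Longrightarrow> P \<subseteq> Q \<Longrightarrow> u \<notin> Q \<Longrightarrow> Q = P"
proof -
  let ?A = "{P. monoid_ideal P M \<and> J \<subseteq> P \<and> u \<notin> P}"
  have "\<exists>P\<in>?A. \<forall>Q\<in>?A. P \<subseteq> Q \<longrightarrow> Q = P"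
  proof (rule subset_Zorn_nonempty)
    show "?A \<noteq> {}"
      using assms by auto
    fix \<C> assume ne: "\<C> \<noteq> {}" and ch: "subset.chain ?A \<C>"
    have sub: "\<And>P. P \<in> \<C> \<Longrightarrow> monoid_ideal P M \<and> J \<subseteq> P \<and> u \<notin> P"
      using ch by (auto simp: subset_chain_def)
    have mult: "x \<otimes> y \<in> \<Union>\<C>" if xy: "x \<in> \<Union>\<C>" "y \<in> \<Union>\<C>" for x y
    proof -
      obtain P where "P \<in> \<C>" "x \<in> P" "y \<in> P"
        using ch xy by (auto simp: subset_chain_def) blast
      then show ?thesis
        using sub[of P] by (auto simp: monoid_ideal_iff)
    qed
    have "monoid_ideal (\<Union>\<C>) M"
      using ne sub mult unfolding monoid_ideal_iff by blast
    then show "\<Union>\<C> \<in> ?A"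
      using ne sub by blast
  qed
  then obtain P where P: "P \<in> ?A" and max: "\<forall>Q\<in>?A. P \<subseteq> Q \<longrightarrow> Q = P"
    by (rule bexE)
  show ?thesis
  proof (rule that[of P])
    show "Q = P" if "monoid_ideal Q M" "P \<subseteq> Q" "u \<notin> Q" for Q
      using P max that by blast
  qed (use P in simp_all)
qed

text \<open>
  The elements below some \<open>p + n a\<close> form the ideal generated by \<open>P\<close> and \<open>a\<close>, which contains \<open>u\<close>
  because it is strictly larger than \<open>P\<close>.
\<close>

lemma in_ideal_generated_over_maximal:
  assumes P: "monoid_ideal P M" "u \<notin> P"
    and max: "\<And>Q. monoid_ideal Q M \<Longrightarrow> P \<subseteq> Q \<Longrightarrow> u \<notin> Q \<Longrightarrow> Q = P"
    and a: "a \<in> carrier M" "a \<notin> P"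
  obtains p n where "p \<in> P" "u divides (p \<otimes> a [^] (n::nat))"
proof -
  define Q where "Q = {x \<in> carrier M. \<exists>p\<in>P. \<exists>n::nat. x divides (p \<otimes> a [^] n)}"
  have P': "P \<subseteq> carrier M" "\<one> \<in> P" "\<And>x y. x \<in> P \<Longrightarrow> y \<in> P \<Longrightarrow> x \<otimes> y \<in> P"
    using P unfolding monoid_ideal_iff by blast+
  have "x \<otimes> y \<in> Q" if xy: "x \<in> Q" "y \<in> Q" for x y
  proof -
    obtain p q and m n :: nat where pq: "p \<in> P" "q \<in> P" "x \<in> carrier M" "y \<in> carrier M"
      "x divides (p \<otimes> a [^] m)" "y divides (q \<otimes> a [^] n)"
      using xy by (auto simp: Q_def)
    have pqC: "p \<in> carrier M" "q \<in> carrier M"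
      using pq P' by auto
    have "(x \<otimes> y) divides ((p \<otimes> a [^] m) \<otimes> (q \<otimes> a [^] n))"
      using pq pqC a by (intro divides_mult_mono) auto
    also have "(p \<otimes> a [^] m) \<otimes> (q \<otimes> a [^] n) = (p \<otimes> q) \<otimes> a [^] (m + n)"
      using pqC a by (simp add: nat_pow_mult[symmetric] m_ac)
    finally show ?thesis
      using pq P'(3)[OF pq(1,2)] unfolding Q_def by blast
  qed
  moreover have PQ: "P \<subseteq> Q"
  proof
    fix x assume x: "x \<in> P"
    then have "x divides (x \<otimes> a [^] (0::nat))"
      using P' by auto
    then show "x \<in> Q"
      using x P'(1) unfolding Q_def by blast
  qed
  moreover have "x \<in> Q" if "y \<in> Q" "x \<in> carrier M" "x divides y" for x y
  proof -
    obtain p and n :: nat where "p \<in> P" "y divides (p \<otimes> a [^] n)"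
      using \<open>y \<in> Q\<close> by (auto simp: Q_def)
    then show ?thesis
      using that(2) divides_trans[OF that(3)] unfolding Q_def by blast
  qed
  ultimately have "monoid_ideal Q M"
    using P'(2) unfolding monoid_ideal_iff Q_def by blast
  moreover have "a \<in> Q"
  proof -
    have "a divides (\<one> \<otimes> a [^] (1::nat))"
      using a by auto
    then show ?thesis
      using a P' unfolding Q_def by blast
  qed
  ultimately have "u \<in> Q"
    using max[of Q] PQ a by blast
  then show ?thesis
    using that unfolding Q_def by blast
qed

text \<open>
  Irreducibility is tested modulo an ideal that is maximal among those which avoid \<open>u\<close> and contain
  every \<open>y \<le> u\<close> with \<open>2y \<le> y\<close>. Both summands of \<open>u\<close> found there generate \<open>u\<close> modulo the ideal, so they
  share an element \<open>c\<close> outside it; but \<open>2c \<le> u\<close> places \<open>c\<close> inside.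
\<close>

theorem double_divides_of_no_irreducible_image:
  assumes u: "u \<in> carrier M"
    and inf: "\<And>y. \<lbrakk>y \<in> carrier M; (y \<otimes> y) divides u\<rbrakk> \<Longrightarrow> (y \<otimes> y) divides y"
    and irr: "\<And>I. monoid_ideal I M \<Longrightarrow>
      \<not> monoid_irreducible (quotient_monoid M I) (monoid_rel M I `` {u})"
  shows "(u \<otimes> u) divides u"
proof -
  define D where "D = {y \<in> carrier M. y divides u \<and> (y \<otimes> y) divides y}"
  define J where "J = {x \<in> carrier M. \<exists>y\<in>D. x divides y}"
  have DC: "D \<subseteq> carrier M"
    by (auto simp: D_def)
  \<comment> \<open>Write \<open>y\<^sub>2 = a + z\<close> with \<open>a \<le> y\<^sub>1\<close> and \<open>z\<close> below the complement of \<open>y\<^sub>1\<close> in \<open>u\<close>; then \<open>y\<^sub>1 + z\<close>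
    stays below \<open>u\<close> and bounds both.\<close>
  have directed: "\<exists>w\<in>D. y\<^sub>1 divides w \<and> y\<^sub>2 divides w" if y: "y\<^sub>1 \<in> D" "y\<^sub>2 \<in> D" for y\<^sub>1 y\<^sub>2
  proof -
    have yC: "y\<^sub>1 \<in> carrier M" "y\<^sub>2 \<in> carrier M"
      and yd: "(y\<^sub>1 \<otimes> y\<^sub>1) divides y\<^sub>1" "(y\<^sub>2 \<otimes> y\<^sub>2) divides y\<^sub>2" "y\<^sub>1 divides u" "y\<^sub>2 divides u"
      using y by (auto simp: D_def)
    obtain t where t: "t \<in> carrier M" "u = y\<^sub>1 \<otimes> t"
      using yd by (auto simp: factor_def)
    obtain a z where az: "a \<in> carrier M" "z \<in> carrier M" "y\<^sub>2 = a \<otimes> z" "a divides y\<^sub>1" "z divides t"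
      using Riesz_decomposition[of y\<^sub>2 y\<^sub>1 t] yC yd t by auto
    define w where "w = y\<^sub>1 \<otimes> z"
    have wC: "w \<in> carrier M"
      using yC az by (auto simp: w_def)
    have "w divides u"
      using yC az t by (auto simp: w_def)
    moreover have y2w: "y\<^sub>2 divides w"
      unfolding az(3) w_def using az yC by auto
    moreover have "y\<^sub>1 divides w"
      using az yC by (auto simp: w_def)
    moreover have "(w \<otimes> w) divides w"
    proof -
      have zz: "(z \<otimes> z) divides w"
      proof -
        have "(z \<otimes> z) divides (y\<^sub>2 \<otimes> y\<^sub>2)"
          using az yC by (intro divides_mult_mono) (auto intro: divides_prod_l)
        then show ?thesis
          using yd y2w yC az wC by (meson divides_trans m_closed)
      qed
      have "w \<otimes> w = (y\<^sub>1 \<otimes> y\<^sub>1) \<otimes> (z \<otimes> z)"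
        unfolding w_def using yC az by (simp add: m_ac)
      also have "\<dots> divides (y\<^sub>1 \<otimes> w)"
        using yd zz yC az wC by (intro divides_mult_mono) auto
      also have "y\<^sub>1 \<otimes> w = (y\<^sub>1 \<otimes> y\<^sub>1) \<otimes> z"
        unfolding w_def using yC az by (simp add: m_ac)
      also have "\<dots> divides w"
        unfolding w_def using yd yC az by auto
      finally show ?thesis
        using yC az wC by simp
    qed
    ultimately show ?thesis
      using wC by (auto simp: D_def)
  qed
  have J: "monoid_ideal J M"
    unfolding monoid_ideal_iff
  proof (intro conjI ballI impI)
    show "J \<subseteq> carrier M"
      by (auto simp: J_def)
    have "\<one> \<in> D"
      using u by (auto simp: D_def factor_def)
    then show "\<one> \<in> J"
      by (auto simp: J_def)
    show "x \<in> J" if "y \<in> J" "x \<in> carrier M" "x divides y" for x y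
    proof -
      obtain w where "w \<in> D" "y divides w"
        using \<open>y \<in> J\<close> by (auto simp: J_def)
      then show ?thesis
        using that(2) divides_trans[OF that(3)] unfolding J_def by blast
    qed
    fix x\<^sub>1 x\<^sub>2 assume x: "x\<^sub>1 \<in> J" "x\<^sub>2 \<in> J"
    then obtain y\<^sub>1 y\<^sub>2 where y: "y\<^sub>1 \<in> D" "y\<^sub>2 \<in> D" "x\<^sub>1 divides y\<^sub>1" "x\<^sub>2 divides y\<^sub>2"
      and xC: "x\<^sub>1 \<in> carrier M" "x\<^sub>2 \<in> carrier M"
      by (auto simp: J_def)
    then obtain w where w: "w \<in> D" "y\<^sub>1 divides w" "y\<^sub>2 divides w"
      using directed by blast
    have "x\<^sub>1 divides w" "x\<^sub>2 divides w"
      using divides_trans[OF y(3) w(2) xC(1)] divides_trans[OF y(4) w(3) xC(2)] by auto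
    then have "(x\<^sub>1 \<otimes> x\<^sub>2) divides (w \<otimes> w)"
      using xC w DC by (intro divides_mult_mono) auto
    then have "(x\<^sub>1 \<otimes> x\<^sub>2) divides w"
      using w xC by (auto simp: D_def intro: divides_trans)
    then show "x\<^sub>1 \<otimes> x\<^sub>2 \<in> J"
      using w xC by (auto simp: J_def)
  qed
  have "u \<in> J"
  proof (rule ccontr)
    assume "u \<notin> J"
    then obtain P where P: "monoid_ideal P M" "J \<subseteq> P" "u \<notin> P"
      and max: "\<And>Q. monoid_ideal Q M \<Longrightarrow> P \<subseteq> Q \<Longrightarrow> u \<notin> Q \<Longrightarrow> Q = P"
      using maximal_ideal_avoiding[OF J] by metis
    obtain a b where ab: "a \<in> carrier M" "b \<in> carrier M" "a \<notin> P" "b \<notin> P" "u = a \<otimes> b"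
      using not_irreducible_split[OF P(1) u P(3) irr[OF P(1)]] .
    obtain p n where p: "p \<in> P" "u divides (p \<otimes> b [^] (n::nat))"
      using in_ideal_generated_over_maximal[OF P(1,3) max ab(2,4)] .
    have "a divides u"
      using ab by auto
    then have "a divides (p \<otimes> b [^] n)"
      using p ab by (auto intro: divides_trans)
    then obtain c where c: "c \<in> carrier M" "c \<notin> P" "c divides a" "c divides b"
      using common_divisor_outside_ideal[OF P(1) ab(1) p(1) ab(2)] ab by auto
    have cu: "(c \<otimes> c) divides u"
      unfolding ab(5) using c ab by (intro divides_mult_mono) auto
    then have "c \<in> D"
      using inf[OF c(1) cu] c ab \<open>a divides u\<close> by (auto simp: D_def intro: divides_trans)
    then have "c \<in> J"
      using c by (auto simp: J_def)
    then show False
      using c P by auto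
  qed
  then obtain y where y: "y \<in> D" "u divides y"
    by (auto simp: J_def)
  then have yC: "y \<in> carrier M" "(y \<otimes> y) divides y" "y divides u"
    by (auto simp: D_def)
  have "(u \<otimes> u) divides (y \<otimes> y)"
    using y yC u by (intro divides_mult_mono)
  then show ?thesis
    using yC u by (meson divides_trans m_closed)
qed

end

section \<open>Idempotent matrices and the order on V(R)\<close>

text \<open>
  When the hypotheses of the ring laws are equations between dimensions instead of memberships in
  carrier sets, no dimension has to be guessed and the laws can serve as rewrite rules.
\<close>

lemma mat_mult_assoc:
  fixes A B C :: "'a::semiring_0 mat"
  shows "dim_col A = dim_row B \<Longrightarrow> dim_col B = dim_row C \<Longrightarrow> A * B * C = A * (B * C)"
  by (rule assoc_mult_mat[of _ "dim_row A" "dim_col A" _ "dim_col B" _ "dim_col C"]) auto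

lemma mat_add_mult_distrib:
  fixes A B C :: "'a::semiring_0 mat"
  assumes "dim_row A = dim_row B" "dim_col A = dim_col B" "dim_col A = dim_row C"
  shows "(A + B) * C = A * C + B * C"
  using assms by (intro add_mult_distrib_mat[of _ "dim_row A" "dim_col A" _ _ "dim_col C"]) auto

lemma mat_mult_add_distrib:
  fixes A B C :: "'a::semiring_0 mat"
  assumes "dim_row B = dim_row C" "dim_col B = dim_col C" "dim_col A = dim_row B"
  shows "A * (B + C) = A * B + A * C"
  using assms by (intro mult_add_distrib_mat[of _ "dim_row A" "dim_col A" _ "dim_col B"]) auto

lemmas mat_ring_simps = mat_mult_assoc mat_add_mult_distrib mat_mult_add_distrib

text \<open>
  For idempotents this is the relation ``\<open>p\<close> is equivalent to a subidempotent of \<open>q\<close>''. Asking for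
  \<open>p = x q y\<close> instead puts it in the form in which pure infiniteness delivers its conclusion.
\<close>

definition idem_dominated :: "'a::ring mat \<Rightarrow> 'a mat \<Rightarrow> bool" (infix \<open>\<lesssim>\<close> 50) where
  "p \<lesssim> q \<longleftrightarrow> (\<exists>x\<in>carrier_mat (dim_row p) (dim_row q). \<exists>y\<in>carrier_mat (dim_row q) (dim_row p).
     p = x * q * y)"

lemma idem_matsD:
  assumes "p \<in> idem_mats"
  shows "p \<in> carrier_mat (dim_row p) (dim_row p)" "p * p = p" "dim_col p = dim_row p"
proof -
  have "square_mat p" and p: "p * p = p"
    using assms unfolding idem_mats_def by blast+
  then have d: "dim_col p = dim_row p"
    by simp
  then show "p \<in> carrier_mat (dim_row p) (dim_row p)" "p * p = p" "dim_col p = dim_row p"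
    using p by blast+
qed

lemma idem_relE:
  assumes "(p, q) \<in> idem_rel"
  obtains x y where "x \<in> carrier_mat (dim_row p) (dim_row q)" "y \<in> carrier_mat (dim_row q) (dim_row p)"
    "p = x * y" "q = y * x" "p \<in> idem_mats" "q \<in> idem_mats"
  using assms unfolding idem_rel_def by blast

lemma idem_relI:
  assumes "p \<in> idem_mats" "q \<in> idem_mats" "dim_row x = dim_row p" "dim_col x = dim_row q"
    "dim_row y = dim_row q" "dim_col y = dim_row p" "p = x * y" "q = y * x"
  shows "(p, q) \<in> idem_rel"
proof -
  have "x \<in> carrier_mat (dim_row p) (dim_row q)" "y \<in> carrier_mat (dim_row q) (dim_row p)"
    using assms(3-6) by auto
  then show ?thesis
    using assms(1,2,7,8) unfolding idem_rel_def by blast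
qed

lemma equiv_idem_rel: "equiv (idem_mats :: 'a::ring mat set) idem_rel"
proof (rule equivI)
  show "idem_rel \<subseteq> idem_mats \<times> (idem_mats :: 'a mat set)"
    by (auto simp: idem_rel_def)
  show "refl_on idem_mats (idem_rel :: 'a mat rel)"
  proof (rule refl_onI)
    fix p :: "'a mat" assume p: "p \<in> idem_mats"
    show "(p, p) \<in> idem_rel"
      by (rule idem_relI[OF p p refl _ refl _ idem_matsD(2)[symmetric] idem_matsD(2)[symmetric]])
        (rule p idem_matsD(3))+
  qed
  show "sym (idem_rel :: 'a mat rel)"
    unfolding sym_def idem_rel_def by blast
  show "trans (idem_rel :: 'a mat rel)"
  proof (rule transI)
    fix p q r :: "'a mat" assume pq: "(p, q) \<in> idem_rel" and qr: "(q, r) \<in> idem_rel"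
    obtain x y where xy: "x \<in> carrier_mat (dim_row p) (dim_row q)"
      "y \<in> carrier_mat (dim_row q) (dim_row p)"
      "p = x * y" "q = y * x" and p: "p \<in> idem_mats"
      using pq by (rule idem_relE)
    obtain z w where zw: "z \<in> carrier_mat (dim_row q) (dim_row r)"
      "w \<in> carrier_mat (dim_row r) (dim_row q)"
      "q = z * w" "r = w * z" and r: "r \<in> idem_mats"
      using qr by (rule idem_relE)
    have d: "dim_row x = dim_row p" "dim_col x = dim_row q" "dim_row y = dim_row q"
      "dim_col y = dim_row p" "dim_row z = dim_row q" "dim_col z = dim_row r"
      "dim_row w = dim_row r" "dim_col w = dim_row q"
      using xy(1,2) zw(1,2) by auto
    have "p = (x * y) * (x * y)"
      using idem_matsD(2)[OF p] xy(3) by simp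
    also have "\<dots> = x * (y * x) * y"
      using d by (simp add: mat_mult_assoc)
    also have "\<dots> = x * (z * w) * y"
      using xy(4) zw(3) by simp
    also have "\<dots> = (x * z) * (w * y)"
      using d by (simp add: mat_mult_assoc)
    finally have pe: "p = (x * z) * (w * y)" .
    have "r = (w * z) * (w * z)"
      using idem_matsD(2)[OF r] zw(4) by simp
    also have "\<dots> = w * (z * w) * z"
      using d by (simp add: mat_mult_assoc)
    also have "\<dots> = w * (y * x) * z"
      using xy(4) zw(3) by simp
    also have "\<dots> = (w * y) * (x * z)"
      using d by (simp add: mat_mult_assoc)
    finally have re: "r = (w * y) * (x * z)" .
    show "(p, r) \<in> idem_rel"
      by (rule idem_relI[OF p r _ _ _ _ pe re]) (use d in auto)
  qed
qed

lemma diag_block_mat_pair: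
  "diag_block_mat [A, B] =
    four_block_mat A (0\<^sub>m (dim_row A) (dim_col B)) (0\<^sub>m (dim_row B) (dim_col A)) B"
  using diag_block_mat_last[of "[A]" B]
  by (simp only: append.simps diag_block_mat_singleton Let_def)

lemma diag_block_mat_pair_mult:
  fixes A B C D :: "'a::ring mat"
  assumes "dim_col A = dim_row C" "dim_col B = dim_row D"
  shows "diag_block_mat [A, B] * diag_block_mat [C, D] = diag_block_mat [A * C, B * D]"
  unfolding diag_block_mat_pair
  by (subst mult_four_block_mat[of _ "dim_row A" "dim_col A" _ "dim_col B" _ "dim_row B" _ _
        "dim_col C" _ "dim_col D"]) (use assms in auto)

lemma diag_block_mat_pair_dim [simp]:
  "dim_row (diag_block_mat [A, B]) = dim_row A + dim_row B"
  "dim_col (diag_block_mat [A, B]) = dim_col A + dim_col B"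
  by (simp_all add: diag_block_mat_pair del: diag_block_mat.simps)

lemma diag_block_mat_pair_idem:
  fixes p q :: "'a::ring mat"
  assumes "p \<in> idem_mats" "q \<in> idem_mats"
  shows "diag_block_mat [p, q] \<in> idem_mats"
  using assms diag_block_mat_pair_mult[of p p q q]
  by (simp add: idem_mats_def del: diag_block_mat.simps)

lemma diag_block_mat_pair_cong:
  assumes "(p, p') \<in> idem_rel" "(q, q') \<in> idem_rel"
  shows "(diag_block_mat [p, q], diag_block_mat [p', q']) \<in> idem_rel"
proof -
  obtain x y where xy: "x \<in> carrier_mat (dim_row p) (dim_row p')"
    "y \<in> carrier_mat (dim_row p') (dim_row p)"
    "p = x * y" "p' = y * x" and p: "p \<in> idem_mats" "p' \<in> idem_mats"
    using assms(1) by (rule idem_relE)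
  obtain z w where zw: "z \<in> carrier_mat (dim_row q) (dim_row q')"
    "w \<in> carrier_mat (dim_row q') (dim_row q)"
    "q = z * w" "q' = w * z" and q: "q \<in> idem_mats" "q' \<in> idem_mats"
    using assms(2) by (rule idem_relE)
  have d: "dim_row x = dim_row p" "dim_col x = dim_row p'" "dim_row y = dim_row p'"
    "dim_col y = dim_row p" "dim_row z = dim_row q" "dim_col z = dim_row q'"
    "dim_row w = dim_row q'" "dim_col w = dim_row q"
    using xy(1,2) zw(1,2) by auto
  show ?thesis
  proof (rule idem_relI)
    show "diag_block_mat [p, q] = diag_block_mat [x, z] * diag_block_mat [y, w]"
      using d xy(3) zw(3) diag_block_mat_pair_mult[of x y z w] by (metis)
    show "diag_block_mat [p', q'] = diag_block_mat [y, w] * diag_block_mat [x, z]"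
      using d xy(4) zw(4) diag_block_mat_pair_mult[of y x w z] by (metis)
  qed (use p q d in \<open>auto intro: diag_block_mat_pair_idem simp del: diag_block_mat.simps\<close>)
qed

text \<open>
  Without an identity in the ring there are no coordinate inclusions and projections. Those cut down
  by \<open>p\<close> and \<open>q\<close> exist and make the block sum a biproduct of \<open>p\<close> and \<open>q\<close>, which reduces later
  computations with blocks to these identities.
\<close>

lemma diag_block_mat_pair_biproduct:
  fixes p q :: "'a::ring mat"
  assumes p: "p \<in> idem_mats" and q: "q \<in> idem_mats"
  defines "m \<equiv> dim_row p" and "n \<equiv> dim_row q"
  obtains i\<^sub>1 i\<^sub>2 p\<^sub>1 p\<^sub>2 where
    "dim_row i\<^sub>1 = m + n" "dim_col i\<^sub>1 = m" "dim_row i\<^sub>2 = m + n" "dim_col i\<^sub>2 = n"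
    "dim_row p\<^sub>1 = m" "dim_col p\<^sub>1 = m + n" "dim_row p\<^sub>2 = n" "dim_col p\<^sub>2 = m + n"
    "p\<^sub>1 * i\<^sub>1 = p" "p\<^sub>1 * i\<^sub>2 = 0\<^sub>m m n" "p\<^sub>2 * i\<^sub>1 = 0\<^sub>m n m" "p\<^sub>2 * i\<^sub>2 = q"
    "i\<^sub>1 * p = i\<^sub>1" "p * p\<^sub>1 = p\<^sub>1" "i\<^sub>2 * q = i\<^sub>2" "q * p\<^sub>2 = p\<^sub>2"
    "i\<^sub>1 * p\<^sub>1 + i\<^sub>2 * p\<^sub>2 = diag_block_mat [p, q]"
proof -
  have pc: "p \<in> carrier_mat m m" "p * p = p" "dim_col p = m" "dim_row p = m"
    and qc: "q \<in> carrier_mat n n" "q * q = q" "dim_col q = n" "dim_row q = n"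
    unfolding m_def n_def by (rule idem_matsD[OF p] idem_matsD[OF q] refl)+
  have corner: "four_block_mat A (0\<^sub>m k 0) (0\<^sub>m 0 l) (0\<^sub>m 0 0) = A"
    if "A \<in> carrier_mat k l" for A :: "'a mat" and k l
    using that by (intro eq_matI) auto
  let ?i\<^sub>1 = "four_block_mat p (0\<^sub>m m 0) (0\<^sub>m n m) (0\<^sub>m n 0)"
  let ?p\<^sub>1 = "four_block_mat p (0\<^sub>m m n) (0\<^sub>m 0 m) (0\<^sub>m 0 n)"
  let ?i\<^sub>2 = "four_block_mat (0\<^sub>m m n) (0\<^sub>m m 0) q (0\<^sub>m n 0)"
  let ?p\<^sub>2 = "four_block_mat (0\<^sub>m n m) q (0\<^sub>m 0 m) (0\<^sub>m 0 n)"
  show ?thesis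
  proof (rule that[of ?i\<^sub>1 ?i\<^sub>2 ?p\<^sub>1 ?p\<^sub>2])
    show "?p\<^sub>1 * ?i\<^sub>1 = p"
      by (subst mult_four_block_mat[of _ m m _ n _ 0 _ _ m _ 0]) (simp_all add: pc qc corner)
    show "?p\<^sub>1 * ?i\<^sub>2 = 0\<^sub>m m n"
      by (subst mult_four_block_mat[of _ m m _ n _ 0 _ _ n _ 0]) (simp_all add: pc qc)
    show "?p\<^sub>2 * ?i\<^sub>1 = 0\<^sub>m n m"
      by (subst mult_four_block_mat[of _ n m _ n _ 0 _ _ m _ 0]) (simp_all add: pc qc)
    show "?p\<^sub>2 * ?i\<^sub>2 = q"
      by (subst mult_four_block_mat[of _ n m _ n _ 0 _ _ n _ 0]) (simp_all add: pc qc corner)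
    have "?i\<^sub>1 * four_block_mat p (0\<^sub>m m 0) (0\<^sub>m 0 m) (0\<^sub>m 0 0) = ?i\<^sub>1"
      by (subst mult_four_block_mat[of _ m m _ 0 _ n _ _ m _ 0]) (simp_all add: pc qc)
    then show "?i\<^sub>1 * p = ?i\<^sub>1"
      by (simp only: corner[OF pc(1)])
    have "four_block_mat p (0\<^sub>m m 0) (0\<^sub>m 0 m) (0\<^sub>m 0 0) * ?p\<^sub>1 = ?p\<^sub>1"
      by (subst mult_four_block_mat[of _ m m _ 0 _ 0 _ _ m _ n]) (simp_all add: pc qc)
    then show "p * ?p\<^sub>1 = ?p\<^sub>1"
      by (simp only: corner[OF pc(1)])
    have "?i\<^sub>2 * four_block_mat q (0\<^sub>m n 0) (0\<^sub>m 0 n) (0\<^sub>m 0 0) = ?i\<^sub>2"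
      by (subst mult_four_block_mat[of _ m n _ 0 _ n _ _ n _ 0]) (simp_all add: pc qc)
    then show "?i\<^sub>2 * q = ?i\<^sub>2"
      by (simp only: corner[OF qc(1)])
    have "four_block_mat q (0\<^sub>m n 0) (0\<^sub>m 0 n) (0\<^sub>m 0 0) * ?p\<^sub>2 = ?p\<^sub>2"
      by (subst mult_four_block_mat[of _ n n _ 0 _ 0 _ _ m _ n]) (simp_all add: pc qc)
    then show "q * ?p\<^sub>2 = ?p\<^sub>2"
      by (simp only: corner[OF qc(1)])
    have "?i\<^sub>1 * ?p\<^sub>1 = four_block_mat p (0\<^sub>m m n) (0\<^sub>m n m) (0\<^sub>m n n)"
      by (subst mult_four_block_mat[of _ m m _ 0 _ n _ _ m _ n]) (simp_all add: pc qc)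
    moreover have "?i\<^sub>2 * ?p\<^sub>2 = four_block_mat (0\<^sub>m m m) (0\<^sub>m m n) (0\<^sub>m n m) q"
      by (subst mult_four_block_mat[of _ m n _ 0 _ n _ _ m _ n]) (simp_all add: pc qc)
    ultimately show "?i\<^sub>1 * ?p\<^sub>1 + ?i\<^sub>2 * ?p\<^sub>2 = diag_block_mat [p, q]"
      unfolding diag_block_mat_pair using pc qc by (intro eq_matI) auto
  qed (simp_all add: pc qc)
qed

lemma mat_minus_mult_distrib:
  fixes A B C :: "'a::ring mat"
  assumes "dim_row A = dim_row B" "dim_col A = dim_col B" "dim_col A = dim_row C"
  shows "(A - B) * C = A * C - B * C"
  using assms by (intro minus_mult_distrib_mat[of _ "dim_row A" "dim_col A" _ _ "dim_col C"]) auto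

lemma mat_mult_minus_distrib:
  fixes A B C :: "'a::ring mat"
  assumes "dim_row B = dim_row C" "dim_col B = dim_col C" "dim_col A = dim_row B"
  shows "A * (B - C) = A * B - A * C"
  using assms by (intro mult_minus_distrib_mat[of _ "dim_row A" "dim_col A" _ "dim_col B"]) auto

text \<open>
  For rewriting with \<open>A * B = C\<close> inside products that are associated to the right.
\<close>

lemma mat_mult_eq_assoc:
  fixes A B C Z :: "'a::semiring_0 mat"
  assumes "A * B = C" "dim_col A = dim_row B" "dim_col B = dim_row Z"
  shows "A * (B * Z) = C * Z"
  using mat_mult_assoc[OF assms(2,3)] assms(1) by simp

lemma mat_zero_add:
  fixes A :: "'a::ring mat"
  assumes "dim_row A = m" "dim_col A = n"
  shows "0\<^sub>m m n + A = A" "A + 0\<^sub>m m n = A"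
  using assms by (auto intro!: eq_matI)

lemma mat_minus_self:
  fixes A :: "'a::ring mat"
  assumes "dim_row A = m" "dim_col A = n"
  shows "A - A = 0\<^sub>m m n"
  using assms by (auto intro!: eq_matI)

text \<open>
  Cutting \<open>x\<close> and \<open>y\<close> down to \<open>X = p x q\<close> and \<open>Y = q y p\<close> gives \<open>X Y = p\<close>, so that \<open>Y X\<close> is a
  subidempotent of \<open>q\<close> equivalent to \<open>p\<close>. The complement is \<open>k = q - Y X\<close>.
\<close>

lemma idem_dominated_complement:
  fixes p q :: "'a::ring mat"
  assumes p: "p \<in> idem_mats" and q: "q \<in> idem_mats" and "p \<lesssim> q"
  shows "\<exists>k\<in>idem_mats. (diag_block_mat [p, k], q) \<in> idem_rel"
proof -
  define m n where "m = dim_row p" and "n = dim_row q"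
  have pd: "dim_row p = m" "dim_col p = m" "p * p = p"
    and qd: "dim_row q = n" "dim_col q = n" "q * q = q"
    using idem_matsD(2,3)[OF p] idem_matsD(2,3)[OF q] by (simp_all add: m_def n_def)
  obtain x y where xyc: "x \<in> carrier_mat m n" "y \<in> carrier_mat n m" and xy: "p = x * q * y"
    using \<open>p \<lesssim> q\<close> unfolding idem_dominated_def pd(1) qd(1) by blast
  have xd: "dim_row x = m" "dim_col x = n" and yd: "dim_row y = n" "dim_col y = m"
    using xyc by simp_all
  define X Y where "X = p * (x * q)" and "Y = q * (y * p)"
  have Xd: "dim_row X = m" "dim_col X = n" and Yd: "dim_row Y = n" "dim_col Y = m"
    by (simp_all add: X_def Y_def pd qd)
  note d = pd(1,2) qd(1,2) xd yd Xd Yd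
  have pX: "p * X = X"
    unfolding X_def using mat_mult_eq_assoc[OF pd(3), of "x * q"] by (simp add: d)
  have Xq: "X * q = X"
    unfolding X_def by (simp add: d mat_mult_assoc qd(3))
  have qY: "q * Y = Y"
    unfolding Y_def using mat_mult_eq_assoc[OF qd(3), of "y * p"] by (simp add: d)
  have Yp: "Y * p = Y"
    unfolding Y_def by (simp add: d mat_mult_assoc pd(3))
  have XY: "X * Y = p"
  proof -
    have "X * Y = p * (x * (q * (q * (y * p))))"
      unfolding X_def Y_def by (simp add: d mat_mult_assoc)
    also have "q * (q * (y * p)) = q * (y * p)"
      using mat_mult_eq_assoc[OF qd(3), of "y * p"] by (simp add: d)
    also have "p * (x * (q * (y * p))) = p * (x * q * y * p)"
      by (simp add: d mat_mult_assoc)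
    also have "\<dots> = p"
      unfolding xy[symmetric] by (simp add: pd(3))
    finally show ?thesis .
  qed
  have YXY: "Y * (X * Y) = Y" and XYX: "X * (Y * X) = X"
    using mat_mult_eq_assoc[OF XY, of X] by (simp_all add: XY Yp pX d)
  define k where "k = q - Y * X"
  have kd: "dim_row k = n" "dim_col k = n"
    by (simp_all add: k_def d)
  have Xk: "X * k = 0\<^sub>m m n"
    unfolding k_def by (simp add: mat_mult_minus_distrib d Xq XYX mat_minus_self)
  have kY: "k * Y = 0\<^sub>m n m"
    unfolding k_def by (simp add: mat_minus_mult_distrib d qY mat_mult_assoc YXY mat_minus_self)
  have kq: "k * q = k"
    unfolding k_def by (simp add: mat_minus_mult_distrib d qd(3) mat_mult_assoc Xq)
  have kk: "k * k = k"
  proof -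
    have "k * k = k * q - k * (Y * X)"
      by (subst (2) k_def) (simp add: mat_mult_minus_distrib d kd)
    also have "k * (Y * X) = 0\<^sub>m n n"
      using mat_mult_eq_assoc[OF kY, of X] by (simp add: d kd)
    also have "k * q - 0\<^sub>m n n = k"
      unfolding kq using kd by (intro eq_matI) auto
    finally show ?thesis .
  qed
  have k: "k \<in> idem_mats"
    using kk kd unfolding idem_mats_def by simp
  obtain i\<^sub>1 i\<^sub>2 p\<^sub>1 p\<^sub>2 where
    bd: "dim_row i\<^sub>1 = m + n" "dim_col i\<^sub>1 = m" "dim_row i\<^sub>2 = m + n" "dim_col i\<^sub>2 = n"
    "dim_row p\<^sub>1 = m" "dim_col p\<^sub>1 = m + n" "dim_row p\<^sub>2 = n" "dim_col p\<^sub>2 = m + n" and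
    b: "p\<^sub>1 * i\<^sub>1 = p" "p\<^sub>1 * i\<^sub>2 = 0\<^sub>m m n" "p\<^sub>2 * i\<^sub>1 = 0\<^sub>m n m" "p\<^sub>2 * i\<^sub>2 = k"
    "i\<^sub>1 * p = i\<^sub>1" "p * p\<^sub>1 = p\<^sub>1" "i\<^sub>2 * k = i\<^sub>2" "k * p\<^sub>2 = p\<^sub>2"
    "i\<^sub>1 * p\<^sub>1 + i\<^sub>2 * p\<^sub>2 = diag_block_mat [p, k]"
    using diag_block_mat_pair_biproduct[OF p k] unfolding pd(1) kd(1) .
  \<comment> \<open>The column \<open>(X, k)\<close> and the row \<open>(Y, k)\<close>.\<close>
  define U where "U = i\<^sub>1 * X + i\<^sub>2 * k"
  define W where "W = Y * p\<^sub>1 + k * p\<^sub>2"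
  note D = d kd bd
  have "U * W = i\<^sub>1 * (X * (Y * p\<^sub>1)) + i\<^sub>2 * (k * (Y * p\<^sub>1)) + (i\<^sub>1 * (X * (k * p\<^sub>2)) + i\<^sub>2 * (k * (k * p\<^sub>2)))"
    unfolding U_def W_def by (simp add: mat_ring_simps D)
  also have "X * (Y * p\<^sub>1) = p\<^sub>1"
    using mat_mult_eq_assoc[OF XY, of p\<^sub>1] by (simp add: D b)
  also have "k * (Y * p\<^sub>1) = 0\<^sub>m n (m + n)"
    using mat_mult_eq_assoc[OF kY, of p\<^sub>1] by (simp add: D)
  also have "X * (k * p\<^sub>2) = 0\<^sub>m m (m + n)"
    using mat_mult_eq_assoc[OF Xk, of p\<^sub>2] by (simp add: D)
  also have "k * (k * p\<^sub>2) = p\<^sub>2"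
    by (simp add: b)
  finally have UW: "U * W = diag_block_mat [p, k]"
    by (simp add: D mat_zero_add b del: diag_block_mat.simps)
  have "W * U = Y * (p\<^sub>1 * (i\<^sub>1 * X)) + k * (p\<^sub>2 * (i\<^sub>1 * X)) + (Y * (p\<^sub>1 * (i\<^sub>2 * k)) + k * (p\<^sub>2 * (i\<^sub>2 * k)))"
    unfolding U_def W_def by (simp add: mat_ring_simps D)
  also have "p\<^sub>1 * (i\<^sub>1 * X) = X"
    using mat_mult_eq_assoc[OF b(1), of X] by (simp add: D pX)
  also have "p\<^sub>2 * (i\<^sub>1 * X) = 0\<^sub>m n n"
    using mat_mult_eq_assoc[OF b(3), of X] by (simp add: D)
  also have "p\<^sub>1 * (i\<^sub>2 * k) = 0\<^sub>m m n"
    by (simp add: b)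
  also have "k * (p\<^sub>2 * (i\<^sub>2 * k)) = k"
    by (simp add: b kk)
  finally have "W * U = Y * X + k"
    by (simp add: D mat_zero_add)
  also have "\<dots> = q"
    unfolding k_def using d by (intro eq_matI) auto
  finally have WU: "W * U = q" .
  have "(diag_block_mat [p, k], q) \<in> idem_rel"
    by (rule idem_relI[OF diag_block_mat_pair_idem[OF p k] q _ _ _ _ UW[symmetric] WU[symmetric]])
      (simp_all add: U_def W_def D del: diag_block_mat.simps)
  then show ?thesis
    using k by blast
qed

text \<open>
  If \<open>p \<oplus> k = x y\<close> and \<open>q = y x\<close>, then \<open>p \<oplus> k = (x y)\<^sup>2 = x q y\<close>, and \<open>p\<close> is cut out of the block sum
  by the inclusion and the projection of the biproduct.
\<close>

lemma idem_dominated_of_summand: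
  fixes p k q :: "'a::ring mat"
  assumes p: "p \<in> idem_mats" and k: "k \<in> idem_mats" and pk: "(diag_block_mat [p, k], q) \<in> idem_rel"
  shows "p \<lesssim> q"
proof -
  define m n where "m = dim_row p" and "n = dim_row k"
  have pd: "dim_row p = m" "dim_col p = m" and kd: "dim_row k = n" "dim_col k = n"
    using idem_matsD(3)[OF p] idem_matsD(3)[OF k] by (simp_all add: m_def n_def)
  obtain i\<^sub>1 i\<^sub>2 p\<^sub>1 p\<^sub>2 where
    bd: "dim_row i\<^sub>1 = m + n" "dim_col i\<^sub>1 = m" "dim_row i\<^sub>2 = m + n" "dim_col i\<^sub>2 = n"
    "dim_row p\<^sub>1 = m" "dim_col p\<^sub>1 = m + n" "dim_row p\<^sub>2 = n" "dim_col p\<^sub>2 = m + n" and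
    b: "p\<^sub>1 * i\<^sub>1 = p" "p\<^sub>1 * i\<^sub>2 = 0\<^sub>m m n" "p\<^sub>2 * i\<^sub>1 = 0\<^sub>m n m" "p\<^sub>2 * i\<^sub>2 = k"
    "i\<^sub>1 * p = i\<^sub>1" "p * p\<^sub>1 = p\<^sub>1" "i\<^sub>2 * k = i\<^sub>2" "k * p\<^sub>2 = p\<^sub>2"
    "i\<^sub>1 * p\<^sub>1 + i\<^sub>2 * p\<^sub>2 = diag_block_mat [p, k]"
    using diag_block_mat_pair_biproduct[OF p k] unfolding pd(1) kd(1) .
  define s where "s = diag_block_mat [p, k]"
  have sd: "dim_row s = m + n" "dim_col s = m + n"
    by (simp_all add: s_def pd kd del: diag_block_mat.simps)
  obtain x y where xyc: "x \<in> carrier_mat (m + n) (dim_row q)" "y \<in> carrier_mat (dim_row q) (m + n)"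
    and xy: "s = x * y" "q = y * x" and q: "q \<in> idem_mats"
    using idem_relE[OF pk[folded s_def]] unfolding sd(1) by blast
  have xd: "dim_row x = m + n" "dim_col x = dim_row q"
    and yd: "dim_row y = dim_row q" "dim_col y = m + n"
    using xyc by simp_all
  have qd: "dim_col q = dim_row q"
    by (rule idem_matsD(3)[OF q])
  have "s * i\<^sub>1 = i\<^sub>1 * (p\<^sub>1 * i\<^sub>1) + i\<^sub>2 * (p\<^sub>2 * i\<^sub>1)"
    unfolding s_def b(9)[symmetric] by (simp add: mat_ring_simps bd)
  then have si: "s * i\<^sub>1 = i\<^sub>1"
    by (simp add: b bd mat_zero_add)
  have "p = p\<^sub>1 * (s * (s * i\<^sub>1))"
    unfolding si b(1) ..
  also have "\<dots> = p\<^sub>1 * (x * (y * (x * (y * i\<^sub>1))))"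
    unfolding xy(1) by (simp add: mat_mult_assoc xd yd bd)
  also have "\<dots> = (p\<^sub>1 * x) * (y * x) * (y * i\<^sub>1)"
    by (simp add: mat_mult_assoc xd yd bd)
  finally have "p = (p\<^sub>1 * x) * q * (y * i\<^sub>1)"
    unfolding xy(2) .
  moreover have "p\<^sub>1 * x \<in> carrier_mat (dim_row p) (dim_row q)"
    "y * i\<^sub>1 \<in> carrier_mat (dim_row q) (dim_row p)"
    by (rule carrier_matI; simp only: index_mult_mat xd yd bd pd)+
  ultimately show ?thesis
    unfolding idem_dominated_def by blast
qed

lemma carrier_V: "carrier (V_monoid TYPE('a::ring)) = (\<lambda>p. idem_rel `` {p}) ` idem_mats"
  by (auto simp: V_monoid_def quotient_def)

lemma V_mult:
  fixes p q :: "'a::ring mat"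
  assumes "p \<in> idem_mats" "q \<in> idem_mats"
  shows "(idem_rel `` {p}) \<otimes>\<^bsub>V_monoid TYPE('a)\<^esub> (idem_rel `` {q}) = idem_rel `` {diag_block_mat [p, q]}"
proof -
  have "congruent2 (idem_rel :: 'a mat rel) idem_rel (\<lambda>p q. idem_rel `` {diag_block_mat [p, q]})"
  proof (rule congruent2I')
    fix p p' q q' :: "'a mat" assume "(p, p') \<in> idem_rel" "(q, q') \<in> idem_rel"
    then show "idem_rel `` {diag_block_mat [p, q]} = idem_rel `` {diag_block_mat [p', q']}"
      by (intro equiv_class_eq[OF equiv_idem_rel] diag_block_mat_pair_cong)
  qed
  from UN_equiv_class2[OF equiv_idem_rel equiv_idem_rel this assms] show ?thesis
    by (simp only: V_monoid_def monoid.simps partial_object.simps)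
qed

lemma V_divides_iff:
  fixes p q :: "'a::ring mat"
  assumes p: "p \<in> idem_mats" and q: "q \<in> idem_mats"
  shows "(idem_rel `` {p}) divides\<^bsub>V_monoid TYPE('a)\<^esub> (idem_rel `` {q}) \<longleftrightarrow> p \<lesssim> q"
proof -
  have eq: "idem_rel `` {q} = idem_rel `` {diag_block_mat [p, k]} \<longleftrightarrow> (diag_block_mat [p, k], q) \<in> idem_rel"
    if "k \<in> idem_mats" for k
    using eq_equiv_class_iff[OF equiv_idem_rel diag_block_mat_pair_idem[OF p that] q] by blast
  have "(idem_rel `` {p}) divides\<^bsub>V_monoid TYPE('a)\<^esub> (idem_rel `` {q}) \<longleftrightarrow>
    (\<exists>k\<in>idem_mats. idem_rel `` {q} = idem_rel `` {diag_block_mat [p, k]})"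
    unfolding factor_def carrier_V by (simp add: V_mult[OF p] del: diag_block_mat.simps)
  also have "\<dots> \<longleftrightarrow> p \<lesssim> q"
    using eq idem_dominated_complement[OF p q] idem_dominated_of_summand[OF p] by blast
  finally show ?thesis .
qed

section \<open>Pure infiniteness\<close>

lemma purely_infinite_two_terms:
  fixes a :: "'a::ring"
  assumes "purely_infinite TYPE('a)"
  shows "\<exists>x y. r\<^sub>1 * a * s\<^sub>1 + r\<^sub>2 * a * s\<^sub>2 = x * a * y"
proof -
  have "r\<^sub>1 * a * s\<^sub>1 + r\<^sub>2 * a * s\<^sub>2 =
      (\<Sum>i<2::nat. (if i = 0 then r\<^sub>1 else r\<^sub>2) * a * (if i = 0 then s\<^sub>1 else s\<^sub>2))"
    by (simp add: numeral_2_eq_2)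
  then have "r\<^sub>1 * a * s\<^sub>1 + r\<^sub>2 * a * s\<^sub>2 \<in> RaR a"
    unfolding RaR_def mem_Collect_eq
    by (intro exI[of _ "2::nat"] exI[of _ "\<lambda>i. if i = 0 then r\<^sub>1 else r\<^sub>2"]
        exI[of _ "\<lambda>i. if i = 0 then s\<^sub>1 else s\<^sub>2"] conjI TrueI)
  then show ?thesis
    using assms unfolding purely_infinite_def by blast
qed

lemma mat_1_1_eqI:
  assumes "dim_row A = 1" "dim_col A = 1" "dim_row B = 1" "dim_col B = 1" "A $$ (0, 0) = B $$ (0, 0)"
  shows "A = B"
  using assms by (intro eq_matI) auto

lemma index_mult_inner_1:
  fixes X Y :: "'a::ring mat"
  assumes "dim_col X = 1" "dim_row Y = 1" "i < dim_row X" "j < dim_col Y"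
  shows "(X * Y) $$ (i, j) = X $$ (i, 0) * Y $$ (0, j)"
  using assms by (simp add: scalar_prod_def)

lemma purely_infinite_two_terms_mat:
  fixes A :: "'a::ring mat"
  assumes pinf: "purely_infinite TYPE('a)"
    and d: "dim_row A = 1" "dim_col A = 1" "dim_row R\<^sub>1 = 1" "dim_col R\<^sub>1 = 1" "dim_row R\<^sub>2 = 1" "dim_col R\<^sub>2 = 1"
    "dim_row S\<^sub>1 = 1" "dim_col S\<^sub>1 = 1" "dim_row S\<^sub>2 = 1" "dim_col S\<^sub>2 = 1"
  obtains X Y where "dim_row X = 1" "dim_col X = 1" "dim_row Y = 1" "dim_col Y = 1"
    "R\<^sub>1 * A * S\<^sub>1 + R\<^sub>2 * A * S\<^sub>2 = X * A * Y"
proof -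
  obtain x y where xy: "R\<^sub>1 $$ (0,0) * A $$ (0,0) * S\<^sub>1 $$ (0,0) + R\<^sub>2 $$ (0,0) * A $$ (0,0) * S\<^sub>2 $$ (0,0) =
      x * A $$ (0,0) * y"
    using purely_infinite_two_terms[OF pinf] by blast
  show ?thesis
  proof (rule that[of "mat 1 1 (\<lambda>_. x)" "mat 1 1 (\<lambda>_. y)"])
    show "R\<^sub>1 * A * S\<^sub>1 + R\<^sub>2 * A * S\<^sub>2 = mat 1 1 (\<lambda>_. x) * A * mat 1 1 (\<lambda>_. y)"
      by (rule mat_1_1_eqI) (simp_all add: d index_mult_inner_1 xy del: index_mult_mat(1))
  qed simp_all
qed

text \<open>
  Write \<open>f \<oplus> f = X Y\<close> where \<open>X\<close> is a column and \<open>Y\<close> a row, with halves \<open>x\<^sub>i\<close> and \<open>y\<^sub>j\<close> satisfying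
  \<open>x\<^sub>i y\<^sub>j = \<delta>\<^sub>i\<^sub>j f\<close>. The elements \<open>y\<^sub>i x\<^sub>i\<close> of \<open>R\<close> are orthogonal idempotents equivalent to \<open>f\<close>, with
  sum \<open>Y X\<close>, and \<open>y\<^sub>2 x\<^sub>2 = (y\<^sub>2 x\<^sub>1) h (y\<^sub>1 x\<^sub>2)\<close> for \<open>h = y\<^sub>1 x\<^sub>1\<close>. Hence \<open>Y X\<close> lies in \<open>RhR\<close> and pure
  infiniteness turns it into \<open>v h w\<close>; substituting this into \<open>f \<oplus> f = X (Y X) Y\<close> exhibits the factor
  \<open>f = x\<^sub>1 y\<^sub>1\<close>.
\<close>

lemma double_dominated_of_double_dominated_by_entry:
  fixes f :: "'a::ring mat"
  assumes pinf: "purely_infinite TYPE('a)"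
    and f: "f \<in> idem_mats" and E: "E \<in> idem_mats" "dim_row E = 1"
    and dom: "diag_block_mat [f, f] \<lesssim> E"
  shows "diag_block_mat [f, f] \<lesssim> f"
proof -
  define m where "m = dim_row f"
  have fd: "dim_row f = m" "dim_col f = m" "f * f = f"
    using idem_matsD(2,3)[OF f] by (simp_all add: m_def)
  have Ed: "dim_row E = 1" "dim_col E = 1"
    using idem_matsD(3)[OF E(1)] E(2) by simp_all
  obtain i\<^sub>1 i\<^sub>2 p\<^sub>1 p\<^sub>2 where
    bd: "dim_row i\<^sub>1 = m + m" "dim_col i\<^sub>1 = m" "dim_row i\<^sub>2 = m + m" "dim_col i\<^sub>2 = m"
    "dim_row p\<^sub>1 = m" "dim_col p\<^sub>1 = m + m" "dim_row p\<^sub>2 = m" "dim_col p\<^sub>2 = m + m" and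
    b: "p\<^sub>1 * i\<^sub>1 = f" "p\<^sub>1 * i\<^sub>2 = 0\<^sub>m m m" "p\<^sub>2 * i\<^sub>1 = 0\<^sub>m m m" "p\<^sub>2 * i\<^sub>2 = f"
    "i\<^sub>1 * f = i\<^sub>1" "f * p\<^sub>1 = p\<^sub>1" "i\<^sub>2 * f = i\<^sub>2" "f * p\<^sub>2 = p\<^sub>2"
    "i\<^sub>1 * p\<^sub>1 + i\<^sub>2 * p\<^sub>2 = diag_block_mat [f, f]"
    using diag_block_mat_pair_biproduct[OF f f] unfolding fd(1) .
  define F where "F = diag_block_mat [f, f]"
  have Fd: "dim_row F = m + m" "dim_col F = m + m"
    by (simp_all add: F_def fd del: diag_block_mat.simps)
  have FF: "F * F = F"
    using idem_matsD(2)[OF diag_block_mat_pair_idem[OF f f]] by (simp only: F_def)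
  have Fip: "F = i\<^sub>1 * p\<^sub>1 + i\<^sub>2 * p\<^sub>2"
    using b(9) by (simp only: F_def)
  obtain x y where xyc: "x \<in> carrier_mat (m + m) 1" "y \<in> carrier_mat 1 (m + m)" and xy: "F = x * E * y"
    using dom unfolding idem_dominated_def F_def[symmetric] Fd(1) Ed(1) by blast
  have xd: "dim_row x = m + m" "dim_col x = 1" and yd: "dim_row y = 1" "dim_col y = m + m"
    using xyc by simp_all
  define X Y where "X = F * (x * E)" and "Y = y * F"
  have Xd: "dim_row X = m + m" "dim_col X = 1" and Yd: "dim_row Y = 1" "dim_col Y = m + m"
    by (simp_all add: X_def Y_def Fd xd yd Ed)
  note d = fd(1,2) Fd Xd Yd bd
  have XY: "X * Y = F"
  proof -
    have "X * Y = F * (x * E * y) * F"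
      unfolding X_def Y_def by (simp add: mat_mult_assoc Fd xd yd Ed)
    then show ?thesis
      unfolding xy[symmetric] by (simp add: FF)
  qed
  have FX: "F * X = X"
    unfolding X_def using mat_mult_eq_assoc[OF FF, of "x * E"] by (simp add: Fd xd)
  have Fi: "F * i\<^sub>1 = i\<^sub>1" "F * i\<^sub>2 = i\<^sub>2"
    unfolding Fip by (simp_all add: mat_ring_simps d b(1-8) mat_zero_add)
  define x\<^sub>1 x\<^sub>2 y\<^sub>1 y\<^sub>2 where "x\<^sub>1 = p\<^sub>1 * X" and "x\<^sub>2 = p\<^sub>2 * X" and "y\<^sub>1 = Y * i\<^sub>1" and "y\<^sub>2 = Y * i\<^sub>2"
  have cd: "dim_row x\<^sub>1 = m" "dim_col x\<^sub>1 = 1" "dim_row x\<^sub>2 = m" "dim_col x\<^sub>2 = 1"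
    "dim_row y\<^sub>1 = 1" "dim_col y\<^sub>1 = m" "dim_row y\<^sub>2 = 1" "dim_col y\<^sub>2 = m"
    by (simp_all add: x\<^sub>1_def x\<^sub>2_def y\<^sub>1_def y\<^sub>2_def d)
  have xy1: "x\<^sub>1 * y\<^sub>1 = f"
    unfolding x\<^sub>1_def y\<^sub>1_def using mat_mult_eq_assoc[OF XY, of i\<^sub>1]
    by (simp add: mat_mult_assoc d Fi b)
  have fx: "f * x\<^sub>1 = x\<^sub>1" "f * x\<^sub>2 = x\<^sub>2"
    unfolding x\<^sub>1_def x\<^sub>2_def using mat_mult_eq_assoc[OF b(6), of X] mat_mult_eq_assoc[OF b(8), of X]
    by (simp_all add: d)
  define h where "h = y\<^sub>1 * x\<^sub>1"
  have hdim: "dim_row h = 1" "dim_col h = 1"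
    by (simp_all add: h_def cd)
  have hh: "h * h = h"
    unfolding h_def using mat_mult_eq_assoc[OF xy1, of x\<^sub>1] by (simp add: mat_mult_assoc cd fx)
  \<comment> \<open>As \<open>F X = X\<close>, inserting \<open>F = i\<^sub>1 p\<^sub>1 + i\<^sub>2 p\<^sub>2\<close> between \<open>Y\<close> and \<open>X\<close> splits \<open>Y X\<close>.\<close>
  have YX: "Y * X = h + y\<^sub>2 * x\<^sub>2"
  proof -
    have "Y * X = Y * (F * X)"
      by (simp only: FX)
    also have "\<dots> = h + y\<^sub>2 * x\<^sub>2"
      unfolding h_def x\<^sub>1_def x\<^sub>2_def y\<^sub>1_def y\<^sub>2_def Fip by (simp add: mat_ring_simps d)
    finally show ?thesis .
  qed
  have "y\<^sub>2 * x\<^sub>2 = y\<^sub>2 * (f * (f * x\<^sub>2))"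
    by (simp only: fx)
  also have "\<dots> = y\<^sub>2 * x\<^sub>1 * h * (y\<^sub>1 * x\<^sub>2)"
    unfolding h_def xy1[symmetric] by (simp add: mat_mult_assoc cd)
  \<comment> \<open>The idempotent \<open>h = h h h\<close> is written so that both summands have the form \<open>r h s\<close>.\<close>
  finally have YX': "Y * X = h * h * h + y\<^sub>2 * x\<^sub>1 * h * (y\<^sub>1 * x\<^sub>2)"
    unfolding YX by (simp only: hh)
  obtain v w where vw: "dim_row v = 1" "dim_col v = 1" "dim_row w = 1" "dim_col w = 1"
    and s: "Y * X = v * h * w"
    by (rule purely_infinite_two_terms_mat[OF pinf hdim, of h "y\<^sub>2 * x\<^sub>1" h "y\<^sub>1 * x\<^sub>2"])
      (simp_all add: hdim cd YX')
  have "F = X * (Y * X) * Y"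
    using mat_mult_eq_assoc[OF XY, of "X * Y"] by (simp add: mat_mult_assoc d XY FF)
  also have "\<dots> = X * (v * (y\<^sub>1 * (f * x\<^sub>1)) * w) * Y"
    unfolding s h_def fx(1) ..
  also have "\<dots> = (X * v * y\<^sub>1) * f * (x\<^sub>1 * w * Y)"
    by (simp add: mat_mult_assoc d cd vw)
  finally have "F = (X * v * y\<^sub>1) * f * (x\<^sub>1 * w * Y)" .
  moreover have "X * v * y\<^sub>1 \<in> carrier_mat (dim_row F) (dim_row f)"
    "x\<^sub>1 * w * Y \<in> carrier_mat (dim_row f) (dim_row F)"
    by (rule carrier_matI; simp only: index_mult_mat d cd)+
  ultimately show ?thesis
    unfolding idem_dominated_def F_def[symmetric] by blast
qed

section \<open>Corners and their matrix rings\<close>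

lemma corner_iff:
  fixes e :: "'a::ring"
  assumes "e * e = e"
  shows "x \<in> corner e \<longleftrightarrow> e * x = x \<and> x * e = x"
proof
  assume "x \<in> corner e"
  then obtain r where "x = e * r * e"
    by (auto simp: corner_def)
  then show "e * x = x \<and> x * e = x"
    using assms by (metis mult.assoc)
next
  assume "e * x = x \<and> x * e = x"
  then have "x = e * x * e"
    by simp
  then show "x \<in> corner e"
    unfolding corner_def by blast
qed

lemma corner_mult:
  fixes e :: "'a::ring"
  assumes "e * e = e" "x \<in> corner e" "y \<in> corner e"
  shows "x * y \<in> corner e"
  using assms by (simp add: corner_iff mult.assoc) (metis mult.assoc)

text \<open>
  The witnesses may be compressed into the corner, as \<open>a = e a e\<close>.
\<close>

lemma properly_infinite_cornerI:
  fixes e :: "'a::ring"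
  assumes e: "e * e = e" and a: "a \<in> corner e"
    and eq: "\<alpha>\<^sub>1 * a * \<beta>\<^sub>1 = a" "\<alpha>\<^sub>1 * a * \<beta>\<^sub>2 = 0" "\<alpha>\<^sub>2 * a * \<beta>\<^sub>1 = 0" "\<alpha>\<^sub>2 * a * \<beta>\<^sub>2 = a"
  obtains \<gamma>\<^sub>1 \<gamma>\<^sub>2 \<delta>\<^sub>1 \<delta>\<^sub>2 where "\<gamma>\<^sub>1 \<in> corner e" "\<gamma>\<^sub>2 \<in> corner e" "\<delta>\<^sub>1 \<in> corner e" "\<delta>\<^sub>2 \<in> corner e"
    "\<gamma>\<^sub>1 * a * \<delta>\<^sub>1 = a" "\<gamma>\<^sub>1 * a * \<delta>\<^sub>2 = 0" "\<gamma>\<^sub>2 * a * \<delta>\<^sub>1 = 0" "\<gamma>\<^sub>2 * a * \<delta>\<^sub>2 = a"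
proof -
  have ea: "e * a = a" "a * e = a"
    using a corner_iff[OF e] by auto
  have c: "(e * \<alpha> * e) * a * (e * \<beta> * e) = e * (\<alpha> * a * \<beta>) * e" for \<alpha> \<beta>
    by (metis ea mult.assoc)
  show ?thesis
    by (rule that[of "e * \<alpha>\<^sub>1 * e" "e * \<alpha>\<^sub>2 * e" "e * \<beta>\<^sub>1 * e" "e * \<beta>\<^sub>2 * e"])
      (auto simp: corner_def c eq ea)
qed

text \<open>
  Multiplying \<open>\<beta>\<^sub>1 a \<alpha>\<^sub>1 + \<beta>\<^sub>2 a \<alpha>\<^sub>2 = x a y\<close> by \<open>\<alpha>\<^sub>i e\<close> on the left and by \<open>e \<beta>\<^sub>j\<close> on the right gives
  \<open>(\<alpha>\<^sub>i e x) a (y e \<beta>\<^sub>j) = \<delta>\<^sub>i\<^sub>j a\<close>.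
\<close>

lemma corner_element_properly_infinite:
  fixes e :: "'a::ring"
  assumes pinf: "purely_infinite TYPE('a)" and e: "e * e = e" and a: "a \<in> corner e"
    and eq: "\<alpha>\<^sub>1 * e * \<beta>\<^sub>1 = e" "\<alpha>\<^sub>1 * e * \<beta>\<^sub>2 = 0" "\<alpha>\<^sub>2 * e * \<beta>\<^sub>1 = 0" "\<alpha>\<^sub>2 * e * \<beta>\<^sub>2 = e"
  obtains \<gamma>\<^sub>1 \<gamma>\<^sub>2 \<delta>\<^sub>1 \<delta>\<^sub>2 where "\<gamma>\<^sub>1 \<in> corner e" "\<gamma>\<^sub>2 \<in> corner e" "\<delta>\<^sub>1 \<in> corner e" "\<delta>\<^sub>2 \<in> corner e"
    "\<gamma>\<^sub>1 * a * \<delta>\<^sub>1 = a" "\<gamma>\<^sub>1 * a * \<delta>\<^sub>2 = 0" "\<gamma>\<^sub>2 * a * \<delta>\<^sub>1 = 0" "\<gamma>\<^sub>2 * a * \<delta>\<^sub>2 = a"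
proof -
  have ea: "e * a = a" "a * e = a"
    using a corner_iff[OF e] by auto
  obtain x y where xy: "\<beta>\<^sub>1 * a * \<alpha>\<^sub>1 + \<beta>\<^sub>2 * a * \<alpha>\<^sub>2 = x * a * y"
    using purely_infinite_two_terms[OF pinf] by blast
  have c: "(\<alpha> * e * x) * a * (y * e * \<beta>) =
      (\<alpha> * e * \<beta>\<^sub>1) * a * (\<alpha>\<^sub>1 * e * \<beta>) + (\<alpha> * e * \<beta>\<^sub>2) * a * (\<alpha>\<^sub>2 * e * \<beta>)" for \<alpha> \<beta>
  proof -
    have "(\<alpha> * e * x) * a * (y * e * \<beta>) = \<alpha> * e * (x * a * y) * e * \<beta>"
      by (simp add: mult.assoc)
    then show ?thesis
      unfolding xy[symmetric] by (simp add: algebra_simps)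
  qed
  show ?thesis
    by (rule properly_infinite_cornerI[OF e a, of "\<alpha>\<^sub>1 * e * x" "y * e * \<beta>\<^sub>1" "y * e * \<beta>\<^sub>2" "\<alpha>\<^sub>2 * e * x"])
      (auto simp: c eq ea intro: that)
qed

text \<open>
  After compression into the corner, take \<open>\<alpha> i = \<alpha>\<^sub>1 \<alpha>\<^sub>2 ^ i\<close> and \<open>\<beta> j = \<beta>\<^sub>2 ^ j \<beta>\<^sub>1\<close>, as for the generators
  of a Cuntz algebra. In \<open>\<alpha> i * \<beta> j\<close> the inner factors cancel until one of the products
  \<open>\<alpha>\<^sub>1 \<beta>\<^sub>1 = e\<close>, \<open>\<alpha>\<^sub>1 \<beta>\<^sub>2 = 0\<close> or \<open>\<alpha>\<^sub>2 \<beta>\<^sub>1 = 0\<close> remains.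
\<close>

lemma corner_infinite_biorthogonal:
  fixes e :: "'a::ring"
  assumes e: "e * e = e"
    and eq: "\<alpha>\<^sub>1 * e * \<beta>\<^sub>1 = e" "\<alpha>\<^sub>1 * e * \<beta>\<^sub>2 = 0" "\<alpha>\<^sub>2 * e * \<beta>\<^sub>1 = 0" "\<alpha>\<^sub>2 * e * \<beta>\<^sub>2 = e"
  shows "\<exists>\<alpha> \<beta> :: nat \<Rightarrow> 'a. (\<forall>i. \<alpha> i \<in> corner e \<and> \<beta> i \<in> corner e) \<and>
    (\<forall>i j. \<alpha> i * \<beta> j = (if i = j then e else 0))"
proof -
  have "e \<in> corner e"
    using e by (simp add: corner_iff)
  then obtain a\<^sub>1 a\<^sub>2 b\<^sub>1 b\<^sub>2 where c: "a\<^sub>1 \<in> corner e" "a\<^sub>2 \<in> corner e" "b\<^sub>1 \<in> corner e" "b\<^sub>2 \<in> corner e"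
    and "a\<^sub>1 * e * b\<^sub>1 = e" "a\<^sub>1 * e * b\<^sub>2 = 0" "a\<^sub>2 * e * b\<^sub>1 = 0" "a\<^sub>2 * e * b\<^sub>2 = e"
    using properly_infinite_cornerI[OF e _ eq] by metis
  then have ab: "a\<^sub>1 * b\<^sub>1 = e" "a\<^sub>1 * b\<^sub>2 = 0" "a\<^sub>2 * b\<^sub>1 = 0" "a\<^sub>2 * b\<^sub>2 = e"
    by (simp_all add: corner_iff[OF e])
  define \<alpha> where "\<alpha> = rec_nat a\<^sub>1 (\<lambda>_ a. a * a\<^sub>2)"
  define \<beta> where "\<beta> = rec_nat b\<^sub>1 (\<lambda>_ b. b\<^sub>2 * b)"
  have rec: "\<alpha> 0 = a\<^sub>1" "\<And>i. \<alpha> (Suc i) = \<alpha> i * a\<^sub>2" "\<beta> 0 = b\<^sub>1" "\<And>i. \<beta> (Suc i) = b\<^sub>2 * \<beta> i"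
    by (simp_all add: \<alpha>_def \<beta>_def)
  have \<alpha>: "\<alpha> i \<in> corner e" for i
    by (induction i) (simp_all add: rec c corner_mult[OF e])
  have \<beta>: "\<beta> i \<in> corner e" for i
    by (induction i) (simp_all add: rec c corner_mult[OF e])
  have "\<alpha> i * \<beta> j = (if i = j then e else 0)" for i j
  proof (induction i arbitrary: j)
    case 0
    show ?case
    proof (cases j)
      case 0 then show ?thesis by (simp add: rec ab)
    next
      case (Suc k)
      then show ?thesis
        by (simp add: rec mult.assoc[symmetric] ab)
    qed
  next
    case (Suc i)
    show ?case
    proof (cases j)
      case 0 then show ?thesis by (simp add: rec mult.assoc ab)
    next
      case j: (Suc k)
      have "\<alpha> (Suc i) * \<beta> j = \<alpha> i * (a\<^sub>2 * b\<^sub>2) * \<beta> k"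
        by (simp add: rec j mult.assoc)
      also have "\<dots> = \<alpha> i * \<beta> k"
        using \<alpha>[of i] by (simp add: ab corner_iff[OF e])
      finally show ?thesis
        by (simp add: Suc.IH j)
    qed
  qed
  then show ?thesis
    using \<alpha> \<beta> by blast
qed

text \<open>
  Let \<open>B\<close> be the row of the \<open>\<beta> j\<close> and \<open>C\<close> the column of the \<open>\<alpha> i\<close>. Then \<open>C B\<close> is the identity of
  \<open>M\<^sub>n(eRe)\<close>, so \<open>A \<mapsto> B A C\<close> embeds \<open>M\<^sub>n(eRe)\<close> into \<open>eRe\<close>, and if \<open>\<gamma>\<close> and \<open>\<delta>\<close> witness that \<open>B A C\<close> is
  properly infinite, then \<open>C \<gamma> B\<close> and \<open>C \<delta> B\<close> do so for \<open>A\<close>.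
\<close>

lemma matrix_rng_corner_properly_purely_infinite:
  fixes e :: "'a::ring"
  assumes pinf: "purely_infinite TYPE('a)" and e: "e * e = e"
    and eq: "\<alpha>\<^sub>1 * e * \<beta>\<^sub>1 = e" "\<alpha>\<^sub>1 * e * \<beta>\<^sub>2 = 0" "\<alpha>\<^sub>2 * e * \<beta>\<^sub>1 = 0" "\<alpha>\<^sub>2 * e * \<beta>\<^sub>2 = e"
  shows "properly_purely_infinite (matrix_rng n (corner e))"
  unfolding properly_purely_infinite_def
proof (intro ballI impI)
  let ?Q = "matrix_rng n (corner e)"
  fix A assume A: "A \<in> carrier ?Q" and A0: "A \<noteq> rzero ?Q"
  have Ac: "A \<in> carrier_mat n n" and AE: "elements_mat A \<subseteq> corner e"
    using A unfolding matrix_rng_def by simp_all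
  have Ad: "dim_row A = n" "dim_col A = n"
    using Ac by simp_all
  have Ae: "A $$ (i, j) \<in> corner e" if "i < n" "j < n" for i j
    using AE elements_matI[OF Ac that refl] by blast
  obtain \<alpha> \<beta> :: "nat \<Rightarrow> 'a" where \<alpha>\<beta>c: "\<And>i. \<alpha> i \<in> corner e" "\<And>i. \<beta> i \<in> corner e"
    and \<alpha>\<beta>: "\<And>i j. \<alpha> i * \<beta> j = (if i = j then e else 0)"
    using corner_infinite_biorthogonal[OF e eq] by blast
  define B where "B = mat 1 n (\<lambda>(_, j). \<beta> j)"
  define C where "C = mat n 1 (\<lambda>(i, _). \<alpha> i)"
  define M where "M = B * A * C"
  define c where "c = M $$ (0, 0)"
  let ?s = "\<lambda>x. mat 1 1 (\<lambda>_. x) :: 'a mat"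
  have d: "dim_row B = 1" "dim_col B = n" "dim_row C = n" "dim_col C = 1" "dim_row M = 1" "dim_col M = 1"
    by (simp_all add: B_def C_def M_def)
  note d = d Ad
  have Be: "B $$ (0, j) = \<beta> j" and Ce: "C $$ (j, 0) = \<alpha> j" if "j < n" for j
    using that by (simp_all add: B_def C_def)
  have CBe: "(C * B) $$ (i, j) = (if i = j then e else 0)" if "i < n" "j < n" for i j
    using that by (simp add: index_mult_inner_1 d Be Ce \<alpha>\<beta> del: index_mult_mat(1))
  have ea: "e * x = x" "x * e = x" if "x \<in> corner e" for x
    using that corner_iff[OF e] by auto
  have CBA: "C * B * A = A"
  proof (rule eq_matI)
    fix i j assume ij: "i < dim_row A" "j < dim_col A"
    then have "(C * B * A) $$ (i, j) = (\<Sum>k<n. (C * B) $$ (i, k) * A $$ (k, j))"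
      by (simp add: d scalar_prod_def atLeast0LessThan)
    also have "\<dots> = (\<Sum>k<n. if i = k then e * A $$ (k, j) else 0)"
      using ij by (intro sum.cong) (simp_all add: CBe d del: index_mult_mat(1))
    also have "\<dots> = A $$ (i, j)"
      using ij by (simp add: d ea Ae)
    finally show "(C * B * A) $$ (i, j) = A $$ (i, j)" .
  qed (simp_all add: d)
  have ACB: "A * (C * B) = A"
  proof (rule eq_matI)
    fix i j assume ij: "i < dim_row A" "j < dim_col A"
    then have "(A * (C * B)) $$ (i, j) = (\<Sum>k<n. A $$ (i, k) * (C * B) $$ (k, j))"
      by (simp add: d scalar_prod_def atLeast0LessThan)
    also have "\<dots> = (\<Sum>k<n. if j = k then A $$ (i, k) * e else 0)"
      using ij by (intro sum.cong) (auto simp add: CBe d simp del: index_mult_mat(1))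
    also have "\<dots> = A $$ (i, j)"
      using ij by (simp add: d ea Ae)
    finally show "(A * (C * B)) $$ (i, j) = A $$ (i, j)" .
  qed (simp_all add: d)
  have eB: "?s e * B = B"
    by (rule eq_matI) (simp_all add: d index_mult_inner_1 Be ea \<alpha>\<beta>c del: index_mult_mat(1))
  have Ce': "C * ?s e = C"
    by (rule eq_matI) (simp_all add: d index_mult_inner_1 Ce ea \<alpha>\<beta>c del: index_mult_mat(1))
  have "?s e * M = M" "M * ?s e = M"
    unfolding M_def using mat_mult_eq_assoc[OF eB, of "A * C"] by (simp_all add: mat_mult_assoc d Ce' del: One_nat_def)
  then have "(?s e * M) $$ (0, 0) = c" "(M * ?s e) $$ (0, 0) = c"
    by (simp_all only: c_def)
  then have "c \<in> corner e"
    unfolding corner_iff[OF e]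
    by (simp add: index_mult_inner_1 d c_def del: index_mult_mat(1) One_nat_def)
  then obtain \<gamma>\<^sub>1 \<gamma>\<^sub>2 \<delta>\<^sub>1 \<delta>\<^sub>2 where \<gamma>\<delta>:
      "\<gamma>\<^sub>1 \<in> corner e" "\<gamma>\<^sub>2 \<in> corner e" "\<delta>\<^sub>1 \<in> corner e" "\<delta>\<^sub>2 \<in> corner e"
    and c: "\<gamma>\<^sub>1 * c * \<delta>\<^sub>1 = c" "\<gamma>\<^sub>1 * c * \<delta>\<^sub>2 = 0" "\<gamma>\<^sub>2 * c * \<delta>\<^sub>1 = 0" "\<gamma>\<^sub>2 * c * \<delta>\<^sub>2 = c"
    using corner_element_properly_infinite[OF pinf e _ eq] by metis
  define G where "G \<gamma> = C * ?s \<gamma> * B" for \<gamma>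
  have G: "G \<gamma> \<in> carrier ?Q" if "\<gamma> \<in> corner e" for \<gamma>
  proof -
    have "G \<gamma> $$ (i, j) \<in> corner e" if ij: "i < n" "j < n" for i j
    proof -
      have "G \<gamma> $$ (i, j) = \<alpha> i * \<gamma> * \<beta> j"
        unfolding G_def using ij by (simp add: index_mult_inner_1 d Be Ce del: index_mult_mat(1))
      then show ?thesis
        using \<alpha>\<beta>c \<open>\<gamma> \<in> corner e\<close> by (simp add: corner_mult[OF e])
    qed
    moreover have Gd: "dim_row (G \<gamma>) = n" "dim_col (G \<gamma>) = n"
      by (simp_all add: G_def d)
    ultimately have "elements_mat (G \<gamma>) \<subseteq> corner e"
      by (intro subsetI) (drule elements_matD, unfold Gd, blast)
    moreover have "G \<gamma> \<in> carrier_mat n n"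
      by (rule carrier_matI) (simp_all only: Gd)
    ultimately show ?thesis
      unfolding matrix_rng_def by simp
  qed
  have GAG: "G \<gamma> * A * G \<delta> = C * ?s (\<gamma> * c * \<delta>) * B" for \<gamma> \<delta>
  proof -
    have "G \<gamma> * A * G \<delta> = C * (?s \<gamma> * M * ?s \<delta>) * B"
      unfolding G_def M_def by (simp add: mat_mult_assoc d)
    also have "?s \<gamma> * M * ?s \<delta> = ?s (\<gamma> * c * \<delta>)"
      by (rule mat_1_1_eqI) (simp_all add: d index_mult_inner_1 c_def del: index_mult_mat(1))
    finally show ?thesis .
  qed
  have "C * ?s c * B = C * M * B"
    using mat_1_1_eqI[of "?s c" M] by (simp add: d c_def del: One_nat_def)
  also have "\<dots> = (C * B * A) * (C * B)"
    unfolding M_def by (simp add: mat_mult_assoc d)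
  finally have Gc: "C * ?s c * B = A"
    by (simp only: CBA ACB)
  have "?s 0 = 0\<^sub>m 1 1"
    by (rule mat_1_1_eqI) simp_all
  then have G0: "C * ?s 0 * B = 0\<^sub>m n n"
    by (simp add: d del: One_nat_def)
  have "G \<gamma>\<^sub>1 * A * G \<delta>\<^sub>1 = A" "G \<gamma>\<^sub>1 * A * G \<delta>\<^sub>2 = 0\<^sub>m n n" "G \<gamma>\<^sub>2 * A * G \<delta>\<^sub>1 = 0\<^sub>m n n" "G \<gamma>\<^sub>2 * A * G \<delta>\<^sub>2 = A"
    unfolding GAG c Gc G0 by (rule refl)+
  moreover have "rmult ?Q = (*)" "rzero ?Q = 0\<^sub>m n n"
    by (simp_all add: matrix_rng_def)
  ultimately show "properly_infinite ?Q A"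
    unfolding properly_infinite_def using A0 G \<gamma>\<delta> by metis
qed

theorem theorem6p10:
  fixes e :: "'a::ring"
  assumes "purely_infinite TYPE('a)"
    and "refinement_monoid (V_monoid TYPE('a))"
    and "e * e = e"
    and "\<And>I. monoid_ideal I (V_monoid TYPE('a)) \<Longrightarrow>
           \<not> monoid_irreducible (quotient_monoid (V_monoid TYPE('a)) I)
               (monoid_rel (V_monoid TYPE('a)) I `` {V_class e})"
  shows "(\<forall>n. properly_purely_infinite (matrix_rng n (corner e))) \<and>
         (e \<noteq> 0 \<longrightarrow> properly_infinite type_rng e)"
proof -
  let ?V = "V_monoid TYPE('a)"
  define E where "E = mat 1 1 (\<lambda>_. e)"
  have Ed: "dim_row E = 1" "dim_col E = 1" "E $$ (0, 0) = e"
    by (simp_all add: E_def)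
  have "E * E = E"
    by (rule mat_1_1_eqI) (simp_all add: Ed index_mult_inner_1 assms(3) del: index_mult_mat(1))
  then have E: "E \<in> idem_mats"
    using Ed unfolding idem_mats_def by simp
  have u: "V_class e = idem_rel `` {E}"
    by (simp only: V_class_def E_def)
  have "(V_class e \<otimes>\<^bsub>?V\<^esub> V_class e) divides\<^bsub>?V\<^esub> V_class e"
  proof (rule refinement_monoid.double_divides_of_no_irreducible_image[OF assms(2)])
    show "V_class e \<in> carrier ?V"
      unfolding u carrier_V using E by blast
    show "(y \<otimes>\<^bsub>?V\<^esub> y) divides\<^bsub>?V\<^esub> y"
      if y: "y \<in> carrier ?V" and yu: "(y \<otimes>\<^bsub>?V\<^esub> y) divides\<^bsub>?V\<^esub> V_class e" for y
    proof -
      obtain f where f: "f \<in> idem_mats" "y = idem_rel `` {f}"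
        using y unfolding carrier_V by blast
      have ff: "diag_block_mat [f, f] \<in> idem_mats"
        by (rule diag_block_mat_pair_idem[OF f(1) f(1)])
      show ?thesis
        using yu double_dominated_of_double_dominated_by_entry[OF assms(1) f(1) E Ed(1)]
        unfolding f(2) u V_mult[OF f(1) f(1)] V_divides_iff[OF ff E] V_divides_iff[OF ff f(1)] by blast
    qed
  qed (rule assms(4))
  then have "diag_block_mat [E, E] \<lesssim> E"
    unfolding u V_mult[OF E E] V_divides_iff[OF diag_block_mat_pair_idem[OF E E] E] .
  then obtain X Y where "X \<in> carrier_mat (1 + 1) 1" "Y \<in> carrier_mat 1 (1 + 1)"
    and XY: "diag_block_mat [E, E] = X * E * Y"
    unfolding idem_dominated_def diag_block_mat_pair_dim Ed by blast
  then have d: "dim_row X = 2" "dim_col X = 1" "dim_row Y = 1" "dim_col Y = 2"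
    by simp_all
  have entry: "X $$ (i, 0) * e * Y $$ (0, j) = diag_block_mat [E, E] $$ (i, j)" if "i < 2" "j < 2" for i j
    unfolding XY using that by (simp add: index_mult_inner_1 d Ed del: index_mult_mat(1))
  have eq: "X $$ (0, 0) * e * Y $$ (0, 0) = e" "X $$ (0, 0) * e * Y $$ (0, 1) = 0"
    "X $$ (1, 0) * e * Y $$ (0, 0) = 0" "X $$ (1, 0) * e * Y $$ (0, 1) = e"
    by (simp_all add: entry diag_block_mat_pair Ed del: diag_block_mat.simps)
  have "properly_infinite type_rng e" if "e \<noteq> 0"
    using that eq unfolding properly_infinite_def type_rng_def by auto
  moreover have "properly_purely_infinite (matrix_rng n (corner e))" for n
    by (rule matrix_rng_corner_properly_purely_infinite[OF assms(1,3) eq])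
  ultimately show ?thesis
    by blast
qed

end
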